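(* The eigenvalues of $\mathbf{P}^{-1/2}\mathcal{H}(\mathbf{A})\mathbf{P}^{-1/2}$ lie in $\left(\frac12,\frac32\right)$.
   Context: Data: $\alpha,\beta,\gamma\in(0,1)$, also written $\delta_1=\alpha,\ \delta_2=\beta,\ \delta_3=\gamma$; real numbers $a_i<b_i$ and positive constants $k_{i,+},k_{i,-}>0$ (not assumed equal) for $i=1,2,3$; $T>0$; positive integers $M,n_1,n_2,n_3$; $\Delta t=T/M$, $h_i=(b_i-a_i)/(n_i+1)$, $N=n_1n_2n_3$, and $\eta_{\delta_i}=\frac{\Delta t}{2\Gamma(\delta_i+1)h_i^{2-\delta_i}}$, i.e. $\eta_\alpha,\eta_\beta,\eta_\gamma$ for $i=1,2,3$. For $\delta\in(0,1)$ set $s_0^{(\delta)}=(\tfrac12)^\delta$, $s_1^{(\delta)}=(\tfrac32)^\delta-2(\tfrac12)^\delta$, $s_k^{(\delta)}=(k+\tfrac12)^\delta-2(k-\tfrac12)^\delta+(k-\tfrac32)^\delta$ for $k\ge2$; $q_0^{(\delta)}=-s_0^{(\delta)}$ and $q_k^{(\delta)}=s_{k-1}^{(\delta)}-s_k^{(\delta)}$ for $k\ge1$. $\mathbf{T}_{n}^{\delta}\in\mathbb{R}^{n\times n}$ is the lower Hessenberg Toeplitz matrix with $(j,k)$ entry $q_{j-k+1}^{(\delta)}$ if $j-k+1\ge0$ and $0$ otherwise. $\mathbf{A}_n\in\mathbb{R}^{n\times n}$ is the symmetric tridiagonal Toeplitz matrix with diagonal entries $6/8$ and sub-/superdiagonal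 entries $1/8$. $\mathbf{B}_{n_i}^{\delta_i}=k_{i,+}\mathbf{T}_{n_i}^{\delta_i}+k_{i,-}(\mathbf{T}_{n_i}^{\delta_i})^{\top}$. For a real square matrix $\mathbf{Z}$, $\mathcal{H}(\mathbf{Z})=(\mathbf{Z}+\mathbf{Z}^\top)/2$. For a real symmetric Toeplitz matrix $T_n=[t_{|j-k|}]_{j,k=1}^n$, its $\tau$ matrix is $\tau(T_n)=\mathbf{S}_n\,\mathrm{diag}(\lambda_1,\dots,\lambda_n)\,\mathbf{S}_n$, where $[\mathbf{S}_n]_{j,k}=\sqrt{\frac{2}{n+1}}\sin\left(\frac{jk\pi}{n+1}\right)$ and $\lambda_k=t_0+2\sum_{j=1}^{n-1}t_j\cos\left(\frac{jk\pi}{n+1}\right)$. With $\otimes$ the Kronecker product, $$\mathbf{A}=\mathbf{A}_{n_3}\otimes\mathbf{A}_{n_2}\otimes\mathbf{A}_{n_1}+\eta_\alpha\,\mathbf{A}_{n_3}\otimes\mathbf{A}_{n_2}\otimes\mathbf{B}_{n_1}^{\alpha}+\eta_\beta\,\mathbf{A}_{n_3}\otimes\mathbf{B}_{n_2}^{\beta}\otimes\mathbf{A}_{n_1}+\eta_\gamma\,\mathbf{B}_{n_3}^{\gamma}\otimes\mathbf{A}_{n_2}\otimes\mathbf{A}_{n_1},$$ $$\mathbf{P}=\mathbf{A}_{n_3}\otimes\mathbf{A}_{n_2}\otimes\mathbf{A}_{n_1}+\eta_\alpha\,\mathbf{A}_{n_3}\otimes\mathbf{A}_{n_2}\otimes\tau(\mathcal{H}(\mathbf{B}_{n_1}^{\alpha}))+\eta_\beta\,\mathbf{A}_{n_3}\otimes\tau(\mathcal{H}(\mathbf{B}_{n_2}^{\beta}))\otimes\mathbf{A}_{n_1}+\eta_\gamma\,\tau(\mathcal{H}(\mathbf{B}_{n_3}^{\gamma}))\otimes\mathbf{A}_{n_2}\otimes\mathbf{A}_{n_1}.$$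 $\mathbf{P}$ is symmetric positive definite and $\mathbf{P}^{-1/2}$ is the inverse of its symmetric positive definite square root. *)

theory Defs
  imports
    "HOL-Analysis.Gamma_Function"
    "Jordan_Normal_Form.Spectral_Radius"
    "Jordan_Normal_Form.Gauss_Jordan_Elimination"
begin

hide_const (open) Finite_Cartesian_Product.mat Finite_Cartesian_Product.vec Finite_Cartesian_Product.row

definition sym_part :: "real mat \<Rightarrow> real mat" where
  "sym_part Z = (1/2) \<cdot>\<^sub>m (Z + transpose_mat Z)"

text \<open>Kronecker product: the (\<open>i\<close>, \<open>j\<close>) block is \<open>A $$ (i, j)\<close> times \<open>B\<close>.\<close>

definition kron :: "real mat \<Rightarrow> real mat \<Rightarrow> real mat" (infixr \<open>\<otimes>\<^sub>K\<close> 75) where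
  "A \<otimes>\<^sub>K B = Matrix.mat (dim_row A * dim_row B) (dim_col A * dim_col B)
     (\<lambda>(i, j). A $$ (i div dim_row B, j div dim_col B) * B $$ (i mod dim_row B, j mod dim_col B))"

definition spd_mat :: "real mat \<Rightarrow> bool" where
  "spd_mat A \<longleftrightarrow> square_mat A \<and> transpose_mat A = A \<and>
     (\<forall>v \<in> carrier_vec (dim_row A). v \<noteq> 0\<^sub>v (dim_row A) \<longrightarrow> 0 < v \<bullet> (A *\<^sub>v v))"

text \<open>Only meaningful for a symmetric positive definite argument, which has a unique
  symmetric positive definite square root; that root is invertible.\<close>

definition spd_sqrt :: "real mat \<Rightarrow> real mat" where
  "spd_sqrt A = (THE R. spd_mat R \<and> R * R = A)"

definition inv_sqrt_mat :: "real mat \<Rightarrow> real mat" where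
  "inv_sqrt_mat A = the (mat_inverse (spd_sqrt A))"

fun s_coeff :: "real \<Rightarrow> nat \<Rightarrow> real" where
  "s_coeff \<delta> 0 = (1/2) powr \<delta>"
| "s_coeff \<delta> (Suc 0) = (3/2) powr \<delta> - 2 * (1/2) powr \<delta>"
| "s_coeff \<delta> k = (real k + 1/2) powr \<delta> - 2 * (real k - 1/2) powr \<delta> + (real k - 3/2) powr \<delta>"

fun q_coeff :: "real \<Rightarrow> nat \<Rightarrow> real" where
  "q_coeff \<delta> 0 = - s_coeff \<delta> 0"
| "q_coeff \<delta> (Suc k) = s_coeff \<delta> k - s_coeff \<delta> (Suc k)"

text \<open>Matrix indices start at \<open>0\<close> here; the Toeplitz index \<open>j - k + 1\<close> is unaffected by the shift.\<close>

definition T_mat :: "nat \<Rightarrow> real \<Rightarrow> real mat" where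
  "T_mat n \<delta> = Matrix.mat n n (\<lambda>(j, k). if k \<le> j + 1 then q_coeff \<delta> (j + 1 - k) else 0)"

definition A_mat :: "nat \<Rightarrow> real mat" where
  "A_mat n = Matrix.mat n n (\<lambda>(j, k). if j = k then 6/8 else if j = k + 1 \<or> k = j + 1 then 1/8 else 0)"

definition B_mat :: "real \<Rightarrow> real \<Rightarrow> nat \<Rightarrow> real \<Rightarrow> real mat" where
  "B_mat kp km n \<delta> = kp \<cdot>\<^sub>m T_mat n \<delta> + km \<cdot>\<^sub>m transpose_mat (T_mat n \<delta>)"

definition S_mat :: "nat \<Rightarrow> real mat" where
  "S_mat n = Matrix.mat n n
     (\<lambda>(j, k). sqrt (2 / (real n + 1)) * sin (real (Suc j) * real (Suc k) * pi / (real n + 1)))"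

text \<open>For a symmetric Toeplitz matrix \<open>T\<close>, the generating entries \<open>t\<^sub>0, \<dots>, t\<^sub>n\<^sub>-\<^sub>1\<close> are
  the first column of \<open>T\<close>. The eigenvalue index \<open>k\<close> in \<open>tau_eigval\<close> starts at \<open>1\<close>.\<close>

definition tau_eigval :: "real mat \<Rightarrow> nat \<Rightarrow> real" where
  "tau_eigval T k = T $$ (0, 0) +
     2 * (\<Sum>j = 1..<dim_row T. T $$ (j, 0) * cos (real j * real k * pi / (real (dim_row T) + 1)))"

definition tau_mat :: "real mat \<Rightarrow> real mat" where
  "tau_mat T = S_mat (dim_row T) * mat_diag (dim_row T) (\<lambda>k. tau_eigval T (Suc k)) * S_mat (dim_row T)"

definition eta :: "real \<Rightarrow> real \<Rightarrow> real \<Rightarrow> real" where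
  "eta dt h \<delta> = dt / (2 * Gamma (\<delta> + 1) * h powr (2 - \<delta>))"

text \<open>In the following, the families \<open>n\<close>, \<open>e\<close>, \<open>X\<close>, \<open>a\<close>, \<open>b\<close>, \<open>kp\<close>, \<open>km\<close>, \<open>\<delta>\<close> are indexed by the
  spatial dimension \<open>1, 2, 3\<close>; their values elsewhere are irrelevant.\<close>

definition kron_combination :: "(nat \<Rightarrow> nat) \<Rightarrow> (nat \<Rightarrow> real) \<Rightarrow> (nat \<Rightarrow> real mat) \<Rightarrow> real mat" where
  "kron_combination n e X =
     A_mat (n 3) \<otimes>\<^sub>K A_mat (n 2) \<otimes>\<^sub>K A_mat (n 1)
     + e 1 \<cdot>\<^sub>m (A_mat (n 3) \<otimes>\<^sub>K A_mat (n 2) \<otimes>\<^sub>K X 1)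
     + e 2 \<cdot>\<^sub>m (A_mat (n 3) \<otimes>\<^sub>K X 2 \<otimes>\<^sub>K A_mat (n 1))
     + e 3 \<cdot>\<^sub>m (X 3 \<otimes>\<^sub>K A_mat (n 2) \<otimes>\<^sub>K A_mat (n 1))"

definition eta_family ::
  "real \<Rightarrow> nat \<Rightarrow> (nat \<Rightarrow> real) \<Rightarrow> (nat \<Rightarrow> real) \<Rightarrow> (nat \<Rightarrow> nat) \<Rightarrow> (nat \<Rightarrow> real) \<Rightarrow> nat \<Rightarrow> real" where
  "eta_family T M a b n \<delta> i = eta (T / real M) ((b i - a i) / (real (n i) + 1)) (\<delta> i)"

definition system_mat ::
  "real \<Rightarrow> nat \<Rightarrow> (nat \<Rightarrow> real) \<Rightarrow> (nat \<Rightarrow> real) \<Rightarrow> (nat \<Rightarrow> real) \<Rightarrow> (nat \<Rightarrow> real) \<Rightarrow>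
   (nat \<Rightarrow> nat) \<Rightarrow> (nat \<Rightarrow> real) \<Rightarrow> real mat" where
  "system_mat T M a b kp km n \<delta> =
     kron_combination n (eta_family T M a b n \<delta>) (\<lambda>i. B_mat (kp i) (km i) (n i) (\<delta> i))"

definition precond_mat ::
  "real \<Rightarrow> nat \<Rightarrow> (nat \<Rightarrow> real) \<Rightarrow> (nat \<Rightarrow> real) \<Rightarrow> (nat \<Rightarrow> real) \<Rightarrow> (nat \<Rightarrow> real) \<Rightarrow>
   (nat \<Rightarrow> nat) \<Rightarrow> (nat \<Rightarrow> real) \<Rightarrow> real mat" where
  "precond_mat T M a b kp km n \<delta> =
     kron_combination n (eta_family T M a b n \<delta>)
       (\<lambda>i. tau_mat (sym_part (B_mat (kp i) (km i) (n i) (\<delta> i))))"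

end

theory Submission
  imports Defs
begin

text \<open>For a symmetric Toeplitz matrix \<open>H\<close> with first column \<open>t\<close>, the correction \<open>H - \<tau>(H)\<close> is the
  Hankel matrix \<open>K\<close> with entries \<open>t\<^sub>j\<^sub>+\<^sub>k\<close> near the upper left corner and \<open>t\<^sub>2\<^sub>n\<^sub>+\<^sub>2\<^sub>-\<^sub>j\<^sub>-\<^sub>k\<close> near the lower right
  corner. Here \<open>t\<close> is nonpositive and increasing off the diagonal and \<open>t\<^sub>0 + 2 (t\<^sub>1 + \<dots> + t\<^sub>n\<^sub>-\<^sub>1) > 0\<close>
  (finite differences of \<open>x \<mapsto> x powr \<delta>\<close>), so \<open>H + K = 2 (H - \<tau>(H)/2)\<close> and
  \<open>H - 3 K = 2 (3\<tau>(H)/2 - H)\<close> are strictly diagonally dominant. Kronecker products with the positive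
  definite matrices \<open>A_mat n\<close> and positive combinations preserve \<open>\<tau>(H)/2 < H < 3\<tau>(H)/2\<close>. Finally,
  \<open>P\<close> is diagonalized by a Kronecker product of the sine matrices, since \<open>A_mat n\<close> is its own
  \<open>\<tau>\<close> matrix; this yields its square root, whose uniqueness comes from \<open>P\<close>'s eigenvectors.\<close>

section \<open>The Toeplitz coefficients\<close>

text \<open>The constants 1/2 and 3/2 have one source. Off the diagonal \<open>H <= K <= 0\<close>
  holds entrywise, because a Hankel entry is either zero or a coefficient of larger index than the
  distance to the diagonal. Hence \<open>|H + c K| <= - H - K\<close> for every \<open>c\<close>
  from -3 to 1, and the two ends of this range are the two matrices above. The reflections in
  \<open>K\<close> only fill places where a row of \<open>H\<close> is cut off, so a row of
  \<open>H + K\<close> uses each off-diagonal coefficient at most twice and the condition on the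
  full sum gives dominance. The obstacle is the coefficient \<open>q_0 + q_2\<close> next to the
  diagonal. It is no difference of powers at equally spaced positive points, so the mean value
  argument that orders the other coefficients does not reach it; an inequality between powers of 3,
  5 and 7 takes its place. The spectrum is complex and the root is a definite description, so
  reality of the eigenvalues and uniqueness of the root have to be proved too.\<close>

definition fwd_diff :: "(real \<Rightarrow> real) \<Rightarrow> real \<Rightarrow> real" where
  "fwd_diff f x = f (x + 1) - f x"

text \<open>Differencing commutes with differentiation. All orders are treated at once so that the
  mean value theorem can be iterated.\<close>

lemma has_real_derivative_fwd_diff_powr:
  assumes "0 < x"
  shows "((fwd_diff ^^ k) (\<lambda>y. y powr a) has_real_derivative
          a * (fwd_diff ^^ k) (\<lambda>y. y powr (a - 1)) x) (at x)"
  using assms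
proof (induction k arbitrary: x)
  case 0
  then show ?case
    by (auto intro!: derivative_eq_intros)
next
  case (Suc k)
  note shift = DERIV_shift[where f = "(fwd_diff ^^ k) (\<lambda>y. y powr a)" and z = 1, THEN iffD1]
  have "((\<lambda>y. (fwd_diff ^^ k) (\<lambda>y. y powr a) (y + 1)) has_real_derivative
          a * (fwd_diff ^^ k) (\<lambda>y. y powr (a - 1)) (x + 1)) (at x)"
    using Suc by (intro shift) (auto simp: add.commute)
  from DERIV_diff[OF this Suc.IH[OF Suc.prems]] show ?case
    by (simp add: fwd_diff_def[abs_def] right_diff_distrib)
qed

text \<open>Each use of the mean value theorem trades the outermost difference for a factor
  \<open>a\<close> and the exponent \<open>a - 1\<close>. Of the intermediate point only positivity
  is kept, since only signs are read off later.\<close>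

lemma fwd_diff_powr_mean_value:
  assumes "0 < x"
  shows "\<exists>y>0. (fwd_diff ^^ k) (\<lambda>y. y powr a) x = (\<Prod>i<k. a - real i) * y powr (a - real k)"
  using assms
proof (induction k arbitrary: a x)
  case 0
  then show ?case by auto
next
  case (Suc k)
  let ?D = "\<lambda>a. (fwd_diff ^^ k) (\<lambda>y. y powr a)"
  have "\<exists>z. x < z \<and> z < x + 1 \<and> ?D a (x + 1) - ?D a x = (x + 1 - x) * (a * ?D (a - 1) z)"
    using Suc.prems by (intro MVT2 has_real_derivative_fwd_diff_powr) auto
  then obtain z where z: "x < z" "?D a (x + 1) - ?D a x = a * ?D (a - 1) z"
    by auto
  obtain y where y: "y > 0" "?D (a - 1) z = (\<Prod>i<k. a - 1 - real i) * y powr (a - 1 - real k)"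
    using Suc.IH[of z "a - 1"] Suc.prems z by auto
  have "(fwd_diff ^^ Suc k) (\<lambda>y. y powr a) x = ?D a (x + 1) - ?D a x"
    by (simp add: fwd_diff_def)
  also have "\<dots> = (\<Prod>i<Suc k. a - real i) * y powr (a - real (Suc k))"
    unfolding prod.lessThan_Suc_shift using z y by (simp add: algebra_simps)
  finally show ?case using y by blast
qed

text \<open>The product \<delta> (\<delta> - 1) (\<delta> - 2) ... changes sign with every factor
  after the first. The orders 2, 3 and 4 give the signs of \<open>s_coeff\<close>, of
  \<open>q_coeff\<close> and of the increments of \<open>q_coeff\<close>.\<close>

lemma powr_diff_signs:
  fixes x \<delta> :: real
  assumes "0 < x" "0 < \<delta>" "\<delta> < 1"
  shows "(x + 2) powr \<delta> - 2 * (x + 1) powr \<delta> + x powr \<delta> < 0"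
    and "(x + 3) powr \<delta> - 3 * (x + 2) powr \<delta> + 3 * (x + 1) powr \<delta> - x powr \<delta> > 0"
    and "(x + 4) powr \<delta> - 4 * (x + 3) powr \<delta> + 6 * (x + 2) powr \<delta> - 4 * (x + 1) powr \<delta>
           + x powr \<delta> < 0"
proof -
  have c: "(\<Prod>i<2. \<delta> - real i) < 0" "(\<Prod>i<3. \<delta> - real i) > 0" "(\<Prod>i<4. \<delta> - real i) < 0"
    using assms by (auto simp: numeral_eq_Suc mult_less_0_iff zero_less_mult_iff)
  let ?D = "\<lambda>k. (fwd_diff ^^ k) (\<lambda>y. y powr \<delta>) x"
  have mv: "\<exists>y>0. ?D k = (\<Prod>i<k. \<delta> - real i) * y powr (\<delta> - real k)" for k
    by (rule fwd_diff_powr_mean_value[OF assms(1)])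
  have neg: "?D k < 0" if "(\<Prod>i<k. \<delta> - real i) < 0" for k
    using that mv[of k] by (metis mult_neg_pos powr_gt_zero less_irrefl)
  have pos: "0 < ?D k" if "0 < (\<Prod>i<k. \<delta> - real i)" for k
    using that mv[of k] by (metis mult_pos_pos powr_gt_zero less_irrefl)
  show "(x + 2) powr \<delta> - 2 * (x + 1) powr \<delta> + x powr \<delta> < 0"
    using neg[OF c(1)] by (simp add: numeral_eq_Suc fwd_diff_def algebra_simps)
  show "(x + 3) powr \<delta> - 3 * (x + 2) powr \<delta> + 3 * (x + 1) powr \<delta> - x powr \<delta> > 0"
    using pos[OF c(2)] by (simp add: numeral_eq_Suc fwd_diff_def algebra_simps)
  show "(x + 4) powr \<delta> - 4 * (x + 3) powr \<delta> + 6 * (x + 2) powr \<delta> - 4 * (x + 1) powr \<delta>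
           + x powr \<delta> < 0"
    using neg[OF c(3)] by (simp add: numeral_eq_Suc fwd_diff_def algebra_simps)
qed

text \<open>From index 2 on, \<open>s_coeff\<close> is a second difference whose smallest point is
  positive; indices 0 and 1 break the pattern. Hence the thresholds 2 for \<open>s_coeff\<close> and
  3 for \<open>q_coeff\<close> below.\<close>

lemma s_coeff_shift:
  "s_coeff \<delta> (m + 2) = (real m + 5/2) powr \<delta> - 2 * (real m + 3/2) powr \<delta> + (real m + 1/2) powr \<delta>"
  by (simp add: numeral_2_eq_2 add.commute)

lemma s_coeff_neg:
  assumes "0 < \<delta>" "\<delta> < 1" "2 \<le> k"
  shows "s_coeff \<delta> k < 0"
proof -
  obtain m where k: "k = m + 2"
    using assms(3) by (metis add.commute le_Suc_ex)
  show ?thesis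
    using powr_diff_signs(1)[of "real m + 1/2" \<delta>] assms
    unfolding k s_coeff_shift by (simp add: add.assoc)
qed

lemma q_coeff_shift:
  "q_coeff \<delta> (m + 3) = - ((real m + 7/2) powr \<delta> - 3 * (real m + 5/2) powr \<delta>
     + 3 * (real m + 3/2) powr \<delta> - (real m + 1/2) powr \<delta>)"
proof -
  have "q_coeff \<delta> (m + 3) = s_coeff \<delta> (m + 2) - s_coeff \<delta> (Suc m + 2)"
    by (simp add: numeral_3_eq_3)
  then show ?thesis
    unfolding s_coeff_shift by (simp add: add.assoc add.commute)
qed

lemma q_coeff_neg:
  assumes "0 < \<delta>" "\<delta> < 1" "3 \<le> k"
  shows "q_coeff \<delta> k < 0"
proof -
  obtain m where k: "k = m + 3"
    using assms(3) by (metis add.commute le_Suc_ex)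
  show ?thesis
    using powr_diff_signs(2)[of "real m + 1/2" \<delta>] assms
    unfolding k q_coeff_shift by (simp add: add.assoc)
qed

lemma q_coeff_le_Suc:
  assumes "0 < \<delta>" "\<delta> < 1" "3 \<le> k"
  shows "q_coeff \<delta> k \<le> q_coeff \<delta> (Suc k)"
proof -
  obtain m where k: "k = m + 3"
    using assms(3) by (metis add.commute le_Suc_ex)
  then have k': "Suc k = Suc m + 3"
    by simp
  show ?thesis
    using powr_diff_signs(3)[of "real m + 1/2" \<delta>] assms
    unfolding k' unfolding k q_coeff_shift by (simp add: add.assoc add.commute)
qed

section \<open>Coefficients on and next to the diagonal\<close>

lemma half_mult_powr: "(real k / 2) powr \<delta> = (1/2) powr \<delta> * real k powr \<delta>"
  by (simp flip: powr_mult)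

lemma q_coeff_1_pos:
  assumes "\<delta> < 1"
  shows "0 < q_coeff \<delta> 1"
proof -
  have "(3::real) powr \<delta> < 3 powr 1"
    using assms by (intro powr_less_mono) auto
  then have "(1/2) powr \<delta> * 3 powr \<delta> < (1/2) powr \<delta> * (3::real)"
    by (intro mult_strict_left_mono) auto
  then show ?thesis
    using half_mult_powr[of 3 \<delta>] by simp
qed

text \<open>Three times the value at 1 of the function \<open>?h\<close> in
  \<open>powr_1_3_5_7_le\<close>.\<close>

lemma powr_3_5_7_deriv_coeff_pos:
  "0 < 18 * ln 3 - 20 * ln 5 + 7 * ln (7::real)"
proof -
  have "ln (5 ^ 20) < ln (3 ^ 18 * 7 ^ 7 :: real)"
    by (subst ln_less_cancel_iff) auto
  then show ?thesis
    by (simp add: ln_mult ln_realpow del: power_numeral)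
qed

text \<open>Settles the sign of the derivative of \<open>?h\<close> in
  \<open>powr_1_3_5_7_le\<close>. The crude bounds \<open>7^4 < 5^5\<close> and
  \<open>7/3 < (5/3)^2\<close> already give the constant 17.5 in place of 20.\<close>

lemma ln_5_7_bound: "7 * (ln 7 * ln (7/3)) < 20 * (ln 5 * ln (5/3 :: real))"
proof -
  have "ln (7 ^ 4) < ln (5 ^ 5 :: real)"
    by (subst ln_less_cancel_iff) auto
  then have 1: "4 * ln 7 \<le> 5 * ln (5::real)"
    by (simp add: ln_realpow del: power_numeral)
  have "ln (7/3) < ln ((5/3) ^ 2 :: real)"
    by (subst ln_less_cancel_iff) (auto simp: power2_eq_square)
  then have 2: "ln (7/3) \<le> 2 * ln (5/3 :: real)"
    by (simp add: ln_realpow del: power_numeral)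
  have "(4 * ln 7) * ln (7/3) \<le> (5 * ln 5) * (2 * ln (5/3 :: real))"
    by (rule mult_mono[OF 1 2]) (auto intro: ln_ge_zero)
  moreover have "0 < ln 5 * ln (5/3 :: real)"
    by (intro mult_pos_pos ln_gt_zero) auto
  ultimately show ?thesis
    by linarith
qed

text \<open>Equality holds at \<open>\<delta> = 1\<close>. The left side minus the right side is increasing on \<open>[0, 1]\<close>: its
  derivative divided by \<open>3 powr \<delta>\<close> is decreasing, and still positive at \<open>1\<close>.\<close>

lemma powr_1_3_5_7_le:
  fixes \<delta> :: real
  assumes "0 < \<delta>" "\<delta> < 1"
  shows "6 * 3 powr \<delta> + 7 powr \<delta> \<le> 5 + 4 * 5 powr \<delta>"
proof -
  let ?g = "\<lambda>x::real. 6 * 3 powr x + 7 powr x - 4 * 5 powr x"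
  let ?h = "\<lambda>x::real. 6 * ln 3 - 4 * ln 5 * (5/3) powr x + ln 7 * (7/3) powr x"
  have h_antimono: "?h 1 \<le> ?h x" if "0 \<le> x" "x \<le> 1" for x
  proof (rule DERIV_nonpos_imp_nonincreasing[OF that(2)])
    fix y assume y: "x \<le> y" "y \<le> 1"
    \<comment> \<open>The derivative of \<open>?h\<close> is \<open>(5/3) powr y\<close> times a
      bracket that increases with \<open>y\<close>, so the bracket only has to be bounded at
      1.\<close>
    have "(7/5) powr y \<le> (7/5::real) powr 1"
      using y by (intro powr_mono) auto
    then have "ln 7 * ln (7/3) * (7/5) powr y \<le> ln 7 * ln (7/3) * (7/5::real)"
      by (intro mult_left_mono) auto
    also have "\<dots> \<le> 4 * (ln 5 * ln (5/3))"
      using ln_5_7_bound by linarith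
    finally have "ln 7 * ln (7/3) * (7/5) powr y - 4 * ln 5 * ln (5/3) \<le> (0::real)"
      by linarith
    then have "(5/3) powr y * (ln 7 * ln (7/3) * (7/5) powr y - 4 * ln 5 * ln (5/3)) \<le> (0::real)"
      by (intro mult_nonneg_nonpos) auto
    moreover have "(5/3) powr y * (7/5) powr y = (7/3::real) powr y"
      by (simp flip: powr_mult)
    ultimately have "ln 7 * ln (7/3) * (7/3) powr y - 4 * ln 5 * ln (5/3) * (5/3) powr y \<le> (0::real)"
      by (simp add: right_diff_distrib mult.left_commute mult.commute)
    moreover have "(?h has_real_derivative
        ln 7 * ln (7/3) * (7/3) powr y - 4 * ln 5 * ln (5/3) * (5/3) powr y) (at y)"
      by (auto intro!: derivative_eq_intros)
    ultimately show "\<exists>d. (?h has_real_derivative d) (at y) \<and> d \<le> 0"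
      by blast
  qed
  have "?g \<delta> \<le> ?g 1"
  proof (rule DERIV_nonneg_imp_nondecreasing[of \<delta> 1])
    fix y assume y: "\<delta> \<le> y" "y \<le> 1"
    have "0 \<le> 3 * ?h 1"
      using powr_3_5_7_deriv_coeff_pos by simp
    then have "0 \<le> ?h y"
      using h_antimono[of y] y assms by simp
    then have "0 \<le> 3 powr y * ?h y"
      by simp
    also have "\<dots> = 6 * ln 3 * 3 powr y - 4 * ln 5 * 5 powr y + ln 7 * 7 powr y"
      by (simp add: algebra_simps flip: powr_mult)
    finally have "0 \<le> 6 * ln 3 * 3 powr y - 4 * ln 5 * 5 powr y + ln 7 * 7 powr y" .
    moreover have "(?g has_real_derivative
        6 * ln 3 * 3 powr y - 4 * ln 5 * 5 powr y + ln 7 * 7 powr y) (at y)"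
      by (auto intro!: derivative_eq_intros)
    ultimately show "\<exists>d. (?g has_real_derivative d) (at y) \<and> 0 \<le> d"
      by blast
  qed (use assms in auto)
  then show ?thesis by simp
qed

text \<open>This is the fourth-difference inequality at the point -1/2 for the odd extension of
  \<open>x powr \<delta>\<close>. That extension is not differentiable at 0, so the mean value
  argument is replaced by \<open>powr_1_3_5_7_le\<close>, scaled by
  \<open>(1/2) powr \<delta>\<close>.\<close>

lemma q_coeff_0_2_le_3:
  assumes "0 < \<delta>" "\<delta> < 1"
  shows "q_coeff \<delta> 0 + q_coeff \<delta> 2 \<le> q_coeff \<delta> 3"
proof -
  have s: "s_coeff \<delta> 1 = (3/2) powr \<delta> - 2 * (1/2) powr \<delta>"
    by simp
  have "q_coeff \<delta> 2 = s_coeff \<delta> 1 - s_coeff \<delta> (0 + 2)"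
    by (simp add: numeral_2_eq_2)
  then have "q_coeff \<delta> 2 = 3 * (3/2) powr \<delta> - 3 * (1/2) powr \<delta> - (5/2) powr \<delta>"
    unfolding s_coeff_shift s by simp
  moreover have "(1/2) powr \<delta> * (6 * 3 powr \<delta> + 7 powr \<delta>) \<le> (1/2) powr \<delta> * (5 + 4 * 5 powr \<delta>)"
    using powr_1_3_5_7_le[OF assms] by (intro mult_left_mono) auto
  ultimately show ?thesis
    using q_coeff_shift[of \<delta> 0] half_mult_powr[of 3 \<delta>] half_mult_powr[of 5 \<delta>] half_mult_powr[of 7 \<delta>]
    by (simp add: algebra_simps)
qed

lemma sum_q_coeff: "(\<Sum>k\<le>n. q_coeff \<delta> k) = - s_coeff \<delta> n"
  by (induction n) auto

text \<open>The entries of \<open>T_mat n \<delta>\<close> plus its transpose, as a function of the distance to the diagonal.\<close>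

definition sym_coeff :: "real \<Rightarrow> nat \<Rightarrow> real" where
  "sym_coeff \<delta> p = (if p = 0 then 2 * q_coeff \<delta> 1 else if p = 1 then q_coeff \<delta> 0 + q_coeff \<delta> 2
     else q_coeff \<delta> (p + 1))"

lemma sym_coeff_le_Suc:
  assumes "0 < \<delta>" "\<delta> < 1" "1 \<le> p"
  shows "sym_coeff \<delta> p \<le> sym_coeff \<delta> (Suc p)"
  using assms q_coeff_le_Suc[of \<delta> "Suc p"] q_coeff_0_2_le_3[of \<delta>]
  by (auto simp: sym_coeff_def numeral_eq_Suc simp del: q_coeff.simps)

lemma sym_coeff_nonpos:
  assumes "0 < \<delta>" "\<delta> < 1" "1 \<le> p"
  shows "sym_coeff \<delta> p \<le> 0"
  using assms q_coeff_neg[of \<delta> "Suc p"] q_coeff_neg[of \<delta> 3] q_coeff_0_2_le_3[of \<delta>]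
  by (auto simp: sym_coeff_def simp del: q_coeff.simps)

text \<open>Each of \<open>q_0\<close>, ..., \<open>q_n\<close> occurs exactly twice on the left,
  and these telescope. The case \<open>n = 2\<close> is the first in which \<open>q_0 + q_2\<close>
  is present.\<close>

lemma sym_coeff_sum:
  assumes "2 \<le> n"
  shows "sym_coeff \<delta> 0 + 2 * (\<Sum>p = 1..<n. sym_coeff \<delta> p) = - 2 * s_coeff \<delta> n"
  using assms
proof (induction n rule: dec_induct)
  case base
  have "(\<Sum>k\<le>2. q_coeff \<delta> k) = - s_coeff \<delta> 2"
    by (rule sum_q_coeff)
  then show ?case
    by (simp add: sym_coeff_def numeral_2_eq_2 del: q_coeff.simps s_coeff.simps)
next
  case (step n)
  then have "q_coeff \<delta> (Suc n) = s_coeff \<delta> n - s_coeff \<delta> (Suc n)"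
    by simp
  with step show ?case
    by (simp add: sym_coeff_def del: q_coeff.simps s_coeff.simps)
qed

lemma sym_coeff_sum_pos:
  assumes "0 < \<delta>" "\<delta> < 1"
  shows "0 < sym_coeff \<delta> 0 + 2 * (\<Sum>p = 1..<n. sym_coeff \<delta> p)"
proof (cases "2 \<le> n")
  case True
  then show ?thesis
    using sym_coeff_sum[of n \<delta>] s_coeff_neg[OF assms True] by simp
next
  case False
  \<comment> \<open>Here \<open>n\<close> is 0 or 1, the sum is empty, and only
    \<open>q_coeff \<delta> 1\<close> remains.\<close>
  then show ?thesis
    using q_coeff_1_pos[OF assms(2)] by (auto simp: sym_coeff_def)
qed

section \<open>Positive definite matrices and Kronecker products\<close>

lemma quad_form_sum:
  fixes A :: "real mat"
  assumes "A \<in> carrier_mat n n" "v \<in> carrier_vec n"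
  shows "v \<bullet> (A *\<^sub>v v) = (\<Sum>i<n. \<Sum>j<n. v $ i * A $$ (i, j) * v $ j)"
  using assms by (auto simp: scalar_prod_def sum_distrib_left mult.assoc lessThan_atLeast0
      intro!: sum.cong)

lemma quad_form_sum':
  fixes A :: "real mat"
  assumes "A \<in> carrier_mat n n"
  shows "Matrix.vec n x \<bullet> (A *\<^sub>v Matrix.vec n x) = (\<Sum>i<n. \<Sum>j<n. x i * A $$ (i, j) * x j)"
  using assms by (subst quad_form_sum[of _ n]) auto

lemma spd_matI:
  assumes "A \<in> carrier_mat n n"
    and "\<And>i j. i < n \<Longrightarrow> j < n \<Longrightarrow> A $$ (i, j) = A $$ (j, i)"
    and "\<And>x. \<exists>i<n. x i \<noteq> 0 \<Longrightarrow> 0 < (\<Sum>i<n. \<Sum>j<n. x i * A $$ (i, j) * x j)"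
  shows "spd_mat A"
  unfolding spd_mat_def
proof (intro conjI ballI impI)
  show "square_mat A"
    using assms(1) by auto
  show "transpose_mat A = A"
    using assms(1,2) by (intro eq_matI) auto
  fix v :: "real vec" assume v: "v \<in> carrier_vec (dim_row A)" "v \<noteq> 0\<^sub>v (dim_row A)"
  have "\<exists>i<n. v $ i \<noteq> 0"
    using assms(1) v by (auto simp: vec_eq_iff)
  from assms(3)[of "vec_index v", OF this] show "0 < v \<bullet> (A *\<^sub>v v)"
    using assms(1) v by (subst quad_form_sum[of _ n]) auto
qed

lemma spd_matD:
  assumes "spd_mat A" "A \<in> carrier_mat n n"
  shows "transpose_mat A = A"
    and "\<And>i j. i < n \<Longrightarrow> j < n \<Longrightarrow> A $$ (i, j) = A $$ (j, i)"
    and "\<And>x. \<exists>i<n. x i \<noteq> 0 \<Longrightarrow> 0 < (\<Sum>i<n. \<Sum>j<n. x i * A $$ (i, j) * x j)"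
proof -
  show tr: "transpose_mat A = A"
    using assms(1) by (simp add: spd_mat_def)
  show "A $$ (i, j) = A $$ (j, i)" if "i < n" "j < n" for i j
    using arg_cong[OF tr, of "\<lambda>B. B $$ (j, i)"] assms(2) that by simp
  show "0 < (\<Sum>i<n. \<Sum>j<n. x i * A $$ (i, j) * x j)" if "\<exists>i<n. x i \<noteq> 0" for x
  proof -
    have "Matrix.vec n x \<noteq> 0\<^sub>v n"
      using that by (auto simp: vec_eq_iff)
    then have "0 < Matrix.vec n x \<bullet> (A *\<^sub>v Matrix.vec n x)"
      using assms by (auto simp: spd_mat_def)
    then show ?thesis
      by (simp add: quad_form_sum'[OF assms(2)])
  qed
qed

lemma spd_mat_quad_pos:
  assumes "spd_mat A" "A \<in> carrier_mat n n" "v \<in> carrier_vec n" "v \<noteq> 0\<^sub>v n"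
  shows "0 < v \<bullet> (A *\<^sub>v v)"
  using assms by (auto simp: spd_mat_def)

lemma spd_mat_add:
  assumes "spd_mat A" "spd_mat B" "A \<in> carrier_mat n n" "B \<in> carrier_mat n n"
  shows "spd_mat (A + B)"
proof (rule spd_matI)
  show "A + B \<in> carrier_mat n n"
    using assms by auto
  show "(A + B) $$ (i, j) = (A + B) $$ (j, i)" if "i < n" "j < n" for i j
    using that assms spd_matD(2)[OF assms(1,3)] spd_matD(2)[OF assms(2,4)] by auto
  show "0 < (\<Sum>i<n. \<Sum>j<n. x i * (A + B) $$ (i, j) * x j)" if "\<exists>i<n. x i \<noteq> 0" for x
    using add_pos_pos[OF spd_matD(3)[OF assms(1,3) that] spd_matD(3)[OF assms(2,4) that]] assms
    by (simp add: distrib_left distrib_right sum.distrib)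
qed

lemma spd_mat_smult:
  assumes "spd_mat A" "0 < c" "A \<in> carrier_mat n n"
  shows "spd_mat (c \<cdot>\<^sub>m A)"
proof (rule spd_matI)
  show "c \<cdot>\<^sub>m A \<in> carrier_mat n n"
    using assms by auto
  show "(c \<cdot>\<^sub>m A) $$ (i, j) = (c \<cdot>\<^sub>m A) $$ (j, i)" if "i < n" "j < n" for i j
    using that assms spd_matD(2)[OF assms(1,3)] by auto
  show "0 < (\<Sum>i<n. \<Sum>j<n. x i * (c \<cdot>\<^sub>m A) $$ (i, j) * x j)" if "\<exists>i<n. x i \<noteq> 0" for x
    using mult_pos_pos[OF assms(2) spd_matD(3)[OF assms(1,3) that]] assms(3)
    by (simp add: sum_distrib_left mult_ac)
qed

text \<open>Bounding \<open>|x_i x_j|\<close> by the mean of the squares and using symmetry leaves a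
  sum of squares weighted by the excess of each diagonal entry over its row.\<close>

lemma diag_dominant_spd:
  assumes "A \<in> carrier_mat n n"
    and sym: "\<And>i j. i < n \<Longrightarrow> j < n \<Longrightarrow> A $$ (i, j) = A $$ (j, i)"
    and dom: "\<And>i. i < n \<Longrightarrow> (\<Sum>j\<in>{..<n} - {i}. \<bar>A $$ (i, j)\<bar>) < A $$ (i, i)"
  shows "spd_mat A"
proof (rule spd_matI[OF assms(1) sym])
  fix x :: "nat \<Rightarrow> real"
  assume x: "\<exists>i<n. x i \<noteq> 0"
  let ?c = "\<lambda>i j. if i = j then 0 else \<bar>A $$ (i, j)\<bar>"
  have row: "(\<Sum>j<n. ?c i j) = (\<Sum>j\<in>{..<n} - {i}. \<bar>A $$ (i, j)\<bar>)" if "i < n" for i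
    using that by (intro sum.mono_neutral_cong_right) auto
  have swap: "(\<Sum>i<n. \<Sum>j<n. ?c i j * (x j)\<^sup>2) = (\<Sum>i<n. \<Sum>j<n. ?c i j * (x i)\<^sup>2)"
  proof (subst sum.swap, intro sum.cong refl)
    fix i j assume "i \<in> {..<n}" "j \<in> {..<n}"
    then show "?c j i * (x i)\<^sup>2 = ?c i j * (x i)\<^sup>2"
      using sym[of i j] by auto
  qed
  have half: "(\<Sum>i<n. \<Sum>j<n. ?c i j * (((x i)\<^sup>2 + (x j)\<^sup>2) / 2)) =
      ((\<Sum>i<n. \<Sum>j<n. ?c i j * (x i)\<^sup>2) + (\<Sum>i<n. \<Sum>j<n. ?c i j * (x j)\<^sup>2)) / 2"
    by (simp only: distrib_left add_divide_distrib sum.distrib sum_divide_distrib times_divide_eq_right)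
  have "0 < (\<Sum>i<n. (A $$ (i, i) - (\<Sum>j<n. ?c i j)) * (x i)\<^sup>2)"
  proof -
    obtain i where i: "i < n" "x i \<noteq> 0"
      using x by blast
    show ?thesis
    proof (rule sum_pos2[of _ i])
      show "0 < (A $$ (i, i) - (\<Sum>j<n. ?c i j)) * (x i)\<^sup>2"
        using i dom row by simp
      show "0 \<le> (A $$ (j, j) - (\<Sum>k<n. ?c j k)) * (x j)\<^sup>2" if "j \<in> {..<n}" for j
        using that dom[of j] row[of j] by simp
    qed (use i in auto)
  qed
  also have "\<dots> = (\<Sum>i<n. A $$ (i, i) * (x i)\<^sup>2) - (\<Sum>i<n. \<Sum>j<n. ?c i j * (x i)\<^sup>2)"
    by (simp add: left_diff_distrib sum_subtractf sum_distrib_right)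
  also have "(\<Sum>i<n. \<Sum>j<n. ?c i j * (x i)\<^sup>2) = (\<Sum>i<n. \<Sum>j<n. ?c i j * (((x i)\<^sup>2 + (x j)\<^sup>2) / 2))"
    unfolding half swap by simp
  also have "(\<Sum>i<n. A $$ (i, i) * (x i)\<^sup>2) =
      (\<Sum>i<n. \<Sum>j<n. if i = j then A $$ (i, j) * x i * x j else 0)"
    by (simp add: power2_eq_square mult.assoc)
  also have "\<dots> - (\<Sum>i<n. \<Sum>j<n. ?c i j * (((x i)\<^sup>2 + (x j)\<^sup>2) / 2)) \<le>
      (\<Sum>i<n. \<Sum>j<n. x i * A $$ (i, j) * x j)"
    unfolding sum_subtractf[symmetric]
  proof (intro sum_mono)
    fix i j
    have "\<bar>x i * x j\<bar> \<le> ((x i)\<^sup>2 + (x j)\<^sup>2) / 2"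
      using zero_le_power2[of "\<bar>x i\<bar> - \<bar>x j\<bar>"] by (simp add: power2_diff abs_mult)
    then have "\<bar>A $$ (i, j)\<bar> * \<bar>x i * x j\<bar> \<le> \<bar>A $$ (i, j)\<bar> * (((x i)\<^sup>2 + (x j)\<^sup>2) / 2)"
      by (rule mult_left_mono) simp
    moreover have "- (\<bar>A $$ (i, j)\<bar> * \<bar>x i * x j\<bar>) \<le> x i * A $$ (i, j) * x j"
      using abs_ge_minus_self[of "x i * A $$ (i, j) * x j"] by (simp add: abs_mult mult_ac)
    ultimately show "(if i = j then A $$ (i, j) * x i * x j else 0) -
        ?c i j * (((x i)\<^sup>2 + (x j)\<^sup>2) / 2) \<le> x i * A $$ (i, j) * x j"
      by (cases "i = j") (simp_all add: mult.assoc)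
  qed
  finally show "0 < (\<Sum>i<n. \<Sum>j<n. x i * A $$ (i, j) * x j)" .
qed

text \<open>Elimination of the last variable: the Schur complement \<open>C\<close> is again
  positive definite, because its form is the minimum of the form of \<open>A\<close> over the last
  coordinate.\<close>

lemma cholesky:
  fixes A :: "nat \<Rightarrow> nat \<Rightarrow> real"
  assumes "\<And>i j. i < n \<Longrightarrow> j < n \<Longrightarrow> A i j = A j i"
    and "\<And>x. \<exists>i<n. x i \<noteq> 0 \<Longrightarrow> 0 < (\<Sum>i<n. \<Sum>j<n. x i * A i j * x j)"
  shows "\<exists>Q. \<forall>i<n. \<forall>j<n. A i j = (\<Sum>l<n. Q l i * Q l j :: real)"
  using assms
proof (induction n arbitrary: A)
  case 0
  then show ?case by simp
next
  case (Suc n)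
  note sym = Suc.prems(1) and pos = Suc.prems(2)
  define a where "a = A n n"
  have a: "0 < a"
    using pos[of "\<lambda>i. if i = n then 1 else 0"] by (simp add: a_def if_distrib cong: if_cong)
  define C where "C i j = A i j - A i n * A n j / a" for i j
  have "\<exists>Q. \<forall>i<n. \<forall>j<n. C i j = (\<Sum>l<n. Q l i * Q l j)"
  proof (rule Suc.IH)
    show "C i j = C j i" if "i < n" "j < n" for i j
      using sym[of i j] sym[of i n] sym[of n j] that by (simp add: C_def)
    fix x :: "nat \<Rightarrow> real"
    assume x: "\<exists>i<n. x i \<noteq> 0"
    define s where "s = (\<Sum>j<n. A n j * x j)"
    \<comment> \<open>The last coordinate is the minimizer for given \<open>x\<close>, so the form
      of \<open>A\<close> at \<open>y\<close> equals the form of \<open>C\<close> at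
      \<open>x\<close>.\<close>
    define y where "y = x(n := - s / a)"
    have s': "(\<Sum>i<n. x i * A i n) = s"
      unfolding s_def by (rule sum.cong) (auto simp: sym)
    define d where "d = - s / a"
    have "(\<Sum>i<Suc n. \<Sum>j<Suc n. y i * A i j * y j) =
        (\<Sum>i<n. (\<Sum>j<n. x i * A i j * x j) + x i * A i n * d) + ((\<Sum>j<n. d * A n j * x j) + d * a * d)"
      by (simp add: y_def d_def a_def)
    also have "\<dots> = (\<Sum>i<n. \<Sum>j<n. x i * A i j * x j) + (\<Sum>i<n. x i * A i n) * d
        + (d * s + d * a * d)"
      by (simp only: sum.distrib sum_distrib_right s_def sum_distrib_left mult.assoc)
    also have "\<dots> = (\<Sum>i<n. \<Sum>j<n. x i * A i j * x j) - s * s / a"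
      using a unfolding s' by (simp add: d_def field_simps)
    also have "s * s / a = (\<Sum>i<n. \<Sum>j<n. x i * (A i n * A n j / a) * x j)"
      by (subst (1) s'[symmetric])
        (simp add: s_def sum_product sum_divide_distrib mult_ac)
    also have "(\<Sum>i<n. \<Sum>j<n. x i * A i j * x j) - \<dots> = (\<Sum>i<n. \<Sum>j<n. x i * C i j * x j)"
      by (simp add: C_def algebra_simps flip: sum_subtractf)
    finally have "(\<Sum>i<Suc n. \<Sum>j<Suc n. y i * A i j * y j) = (\<Sum>i<n. \<Sum>j<n. x i * C i j * x j)" .
    moreover have "\<exists>i<Suc n. y i \<noteq> 0"
      using x by (auto simp: y_def less_Suc_eq)
    ultimately show "0 < (\<Sum>i<n. \<Sum>j<n. x i * C i j * x j)"
      using pos[of y] by metis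
  qed
  then obtain Q where Q: "\<And>i j. i < n \<Longrightarrow> j < n \<Longrightarrow> C i j = (\<Sum>l<n. Q l i * Q l j)"
    by blast
  \<comment> \<open>The new row \<open>n\<close> contributes the rank-one term subtracted in
    \<open>C\<close>, and column \<open>n\<close> vanishes in all other rows.\<close>
  define Q' where "Q' l i = (if l = n then A n i / sqrt a else if i = n then 0 else Q l i)" for l i
  have "A i j = (\<Sum>l<Suc n. Q' l i * Q' l j)" if ij: "i < Suc n" "j < Suc n" for i j
  proof -
    have last: "Q' n i * Q' n j = A n i * A n j / a"
      using a by (simp add: Q'_def flip: real_sqrt_mult)
    show ?thesis
    proof (cases "i = n \<or> j = n")
      case True
      then have "(\<Sum>l<n. Q' l i * Q' l j) = 0"
        by (intro sum.neutral) (auto simp: Q'_def)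
      then show ?thesis
        using True last a sym[of i j] ij by (auto simp: a_def)
    next
      case False
      then have ij': "i < n" "j < n"
        using ij by auto
      then have "(\<Sum>l<n. Q' l i * Q' l j) = C i j"
        by (subst Q) (auto simp: Q'_def)
      then show ?thesis
        using last sym[of n i] ij' by (simp add: C_def)
    qed
  qed
  then show ?case by blast
qed

section \<open>Kronecker products\<close>

lemma kron_carrier [intro, simp]:
  "A \<in> carrier_mat m n \<Longrightarrow> B \<in> carrier_mat m' n' \<Longrightarrow> A \<otimes>\<^sub>K B \<in> carrier_mat (m * m') (n * n')"
  by (auto simp: kron_def)

lemma div_mod_less_mult:
  assumes "i < m * (k::nat)"
  shows "i div k < m" "i mod k < k"
proof -
  have "0 < k"
    using assms by (cases k) auto
  then show "i div k < m" "i mod k < k"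
    using assms by (auto simp: less_mult_imp_div_less)
qed

lemma kron_index:
  assumes "A \<in> carrier_mat m n" "B \<in> carrier_mat m' n'" "i < m * m'" "j < n * n'"
  shows "(A \<otimes>\<^sub>K B) $$ (i, j) = A $$ (i div m', j div n') * B $$ (i mod m', j mod n')"
  using assms by (auto simp: kron_def)

lemma sum_div_mod:
  fixes f :: "nat \<Rightarrow> nat \<Rightarrow> 'a::comm_monoid_add"
  shows "(\<Sum>k<m * n. f (k div n) (k mod n)) = (\<Sum>i<m. \<Sum>j<n. f i j)"
proof -
  have "(\<Sum>k<m * n. f (k div n) (k mod n)) = (\<Sum>i<m. \<Sum>k=i*n..<i*n+n. f (k div n) (k mod n))"
    by (rule sum.nat_group[symmetric])
  also have "\<dots> = (\<Sum>i<m. \<Sum>j<n. f i j)"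
  proof (rule sum.cong[OF refl])
    fix i
    have "(\<Sum>k=0+i*n..<n+i*n. f (k div n) (k mod n)) =
        (\<Sum>j=0..<n. f ((j + i * n) div n) ((j + i * n) mod n))"
      by (rule sum.shift_bounds_nat_ivl)
    also have "\<dots> = (\<Sum>j<n. f i j)"
      by (auto simp: lessThan_atLeast0 intro!: sum.cong)
    finally show "(\<Sum>k=i*n..<i*n+n. f (k div n) (k mod n)) = (\<Sum>j<n. f i j)"
      by (simp add: add.commute)
  qed
  finally show ?thesis .
qed

text \<open>With \<open>A = Q\<^sup>T Q\<close>, the quadratic form of the Kronecker product is a sum of values of the
  quadratic form of \<open>B\<close>, at the vectors \<open>Y l\<close> below.\<close>

lemma kron_spd:
  assumes "spd_mat A" "spd_mat B" and A: "A \<in> carrier_mat m m" and B: "B \<in> carrier_mat n n"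
  shows "spd_mat (A \<otimes>\<^sub>K B)"
proof (rule spd_matI)
  note AD = spd_matD[OF assms(1) A] and BD = spd_matD[OF assms(2) B]
  show "A \<otimes>\<^sub>K B \<in> carrier_mat (m * n) (m * n)"
    using A B by simp
  show "(A \<otimes>\<^sub>K B) $$ (i, j) = (A \<otimes>\<^sub>K B) $$ (j, i)" if "i < m * n" "j < m * n" for i j
    using that div_mod_less_mult[OF that(1)] div_mod_less_mult[OF that(2)]
      AD(2)[of "i div n"] BD(2)[of "i mod n"]
    by (simp add: kron_index[OF A B])
  fix x :: "nat \<Rightarrow> real"
  assume "\<exists>i<m * n. x i \<noteq> 0"
  then obtain i0 where i0: "i0 < m * n" "x i0 \<noteq> 0"
    by blast
  obtain Q where Q: "\<And>i j. i < m \<Longrightarrow> j < m \<Longrightarrow> A $$ (i, j) = (\<Sum>l<m. Q l i * Q l j)"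
    using cholesky[of m "\<lambda>i j. A $$ (i, j)"] AD by blast
  define X where "X i j = x (i * n + j)" for i j
  define Y where "Y l j = (\<Sum>i<m. Q l i * X i j)" for l j
  have x: "x i = X (i div n) (i mod n)" for i
    by (simp add: X_def)
  have BY: "0 \<le> (\<Sum>j<n. \<Sum>j'<n. Y l j * B $$ (j, j') * Y l j')" for l
    using BD(3)[of "Y l"] by (cases "\<exists>j<n. Y l j \<noteq> 0") (auto intro!: sum_nonneg less_imp_le)
  \<comment> \<open>If all \<open>Y l j\<close> vanished, the form of \<open>A\<close> at a nonzero
    column of \<open>X\<close> would be a sum of squares of zeros.\<close>
  have "\<exists>l<m. \<exists>j<n. Y l j \<noteq> 0"
  proof (rule ccontr)
    assume "\<not> ?thesis"
    then have Y0: "Y l j = 0" if "l < m" "j < n" for l j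
      using that by blast
    define j where "j = i0 mod n"
    have j: "j < n" "i0 div n < m" "X (i0 div n) j \<noteq> 0"
      using i0 x[of i0] div_mod_less_mult[OF i0(1)] by (auto simp: j_def)
    have "(\<Sum>i<m. \<Sum>i'<m. X i j * A $$ (i, i') * X i' j) =
        (\<Sum>i<m. \<Sum>i'<m. \<Sum>l<m. (Q l i * X i j) * (Q l i' * X i' j))"
      by (intro sum.cong refl) (simp add: Q sum_distrib_left sum_distrib_right mult_ac)
    also have "\<dots> = (\<Sum>i<m. \<Sum>l<m. \<Sum>i'<m. (Q l i * X i j) * (Q l i' * X i' j))"
      by (intro sum.cong refl sum.swap)
    also have "\<dots> = (\<Sum>l<m. \<Sum>i<m. \<Sum>i'<m. (Q l i * X i j) * (Q l i' * X i' j))"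
      by (rule sum.swap)
    also have "\<dots> = (\<Sum>l<m. Y l j * Y l j)"
      by (simp add: Y_def sum_product)
    also have "\<dots> = 0"
      using Y0 j by simp
    finally show False
      using AD(3)[of "\<lambda>i. X i j"] j by auto
  qed
  then obtain l0 where l0: "l0 < m" "\<exists>j<n. Y l0 j \<noteq> 0"
    by blast
  have "0 < (\<Sum>l<m. \<Sum>j<n. \<Sum>j'<n. Y l j * B $$ (j, j') * Y l j')"
    by (rule sum_pos2[of _ l0]) (use l0 BY BD(3)[of "Y l0"] in auto)
  \<comment> \<open>The exchanges first move \<open>l\<close> innermost, where products of
    \<open>Q\<close> add up to entries of \<open>A\<close>, and then arrange the pairs
    \<open>(i, j)\<close> and \<open>(i', j')\<close> for \<open>sum_div_mod\<close>.\<close>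
  also have "\<dots> = (\<Sum>l<m. \<Sum>j<n. \<Sum>j'<n. \<Sum>i<m. \<Sum>i'<m.
      Q l i * X i j * B $$ (j, j') * (Q l i' * X i' j'))"
    by (simp add: Y_def sum_product sum_distrib_left sum_distrib_right mult_ac)
  also have "\<dots> = (\<Sum>j<n. \<Sum>l<m. \<Sum>j'<n. \<Sum>i<m. \<Sum>i'<m.
      Q l i * X i j * B $$ (j, j') * (Q l i' * X i' j'))"
    by (rule sum.swap)
  also have "\<dots> = (\<Sum>j<n. \<Sum>j'<n. \<Sum>l<m. \<Sum>i<m. \<Sum>i'<m.
      Q l i * X i j * B $$ (j, j') * (Q l i' * X i' j'))"
    by (intro sum.cong refl sum.swap)
  also have "\<dots> = (\<Sum>j<n. \<Sum>j'<n. \<Sum>i<m. \<Sum>l<m. \<Sum>i'<m.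
      Q l i * X i j * B $$ (j, j') * (Q l i' * X i' j'))"
    by (intro sum.cong refl sum.swap)
  also have "\<dots> = (\<Sum>j<n. \<Sum>j'<n. \<Sum>i<m. \<Sum>i'<m. \<Sum>l<m.
      Q l i * X i j * B $$ (j, j') * (Q l i' * X i' j'))"
    by (intro sum.cong refl sum.swap)
  also have "\<dots> = (\<Sum>j<n. \<Sum>j'<n. \<Sum>i<m. \<Sum>i'<m.
      X i j * (A $$ (i, i') * B $$ (j, j')) * X i' j')"
    by (intro sum.cong refl) (simp add: Q sum_distrib_left sum_distrib_right mult_ac)
  also have "\<dots> = (\<Sum>j<n. \<Sum>i<m. \<Sum>j'<n. \<Sum>i'<m.
      X i j * (A $$ (i, i') * B $$ (j, j')) * X i' j')"
    by (intro sum.cong refl sum.swap)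
  also have "\<dots> = (\<Sum>i<m. \<Sum>j<n. \<Sum>j'<n. \<Sum>i'<m.
      X i j * (A $$ (i, i') * B $$ (j, j')) * X i' j')"
    by (rule sum.swap)
  also have "\<dots> = (\<Sum>i<m. \<Sum>j<n. \<Sum>i'<m. \<Sum>j'<n.
      X i j * (A $$ (i, i') * B $$ (j, j')) * X i' j')"
    by (intro sum.cong refl sum.swap)
  also have "\<dots> = (\<Sum>k<m * n. \<Sum>i'<m. \<Sum>j'<n.
      X (k div n) (k mod n) * (A $$ (k div n, i') * B $$ (k mod n, j')) * X i' j')"
    by (rule sum_div_mod[symmetric])
  also have "\<dots> = (\<Sum>k<m * n. \<Sum>k'<m * n. X (k div n) (k mod n) *
      (A $$ (k div n, k' div n) * B $$ (k mod n, k' mod n)) * X (k' div n) (k' mod n))"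
    by (intro sum.cong refl sum_div_mod[symmetric])
  also have "\<dots> = (\<Sum>k<m * n. \<Sum>k'<m * n. x k * (A \<otimes>\<^sub>K B) $$ (k, k') * x k')"
    by (intro sum.cong refl) (simp add: kron_index[OF A B] flip: x)
  finally show "0 < (\<Sum>k<m * n. \<Sum>k'<m * n. x k * (A \<otimes>\<^sub>K B) $$ (k, k') * x k')" .
qed

section \<open>Sine transform and \<open>\<tau>\<close> matrices\<close>

lemma S_mat_carrier [simp]: "S_mat n \<in> carrier_mat n n"
  by (simp add: S_mat_def)

lemma transpose_S_mat [simp]: "transpose_mat (S_mat n) = S_mat n"
  by (rule eq_matI) (auto simp: S_mat_def mult_ac)

lemma dirichlet_kernel_sum:
  fixes x :: real
  shows "2 * sin (x / 2) * (\<Sum>k<n. cos (real (Suc k) * x)) = sin ((real n + 1/2) * x) - sin (x / 2)"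
proof (induction n)
  case 0
  then show ?case by simp
next
  case (Suc n)
  have e: "x / 2 + real (Suc n) * x = (real (Suc n) + 1/2) * x"
      "x / 2 - real (Suc n) * x = - ((real n + 1/2) * x)"
    by (auto simp: field_simps)
  have "2 * sin (x / 2) * cos (real (Suc n) * x) =
      sin ((real (Suc n) + 1/2) * x) - sin ((real n + 1/2) * x)"
    unfolding sin_times_cos[of "x / 2"] mult.assoc e by simp
  with Suc show ?case
    by (simp add: distrib_left)
qed

text \<open>At these nodes \<open>(n + 1/2) x\<close> equals \<open>m pi - x/2\<close>, so the
  kernel depends only on the parity of \<open>m\<close>. The range of \<open>m\<close> keeps
  \<open>sin (x/2)\<close> away from 0.\<close>

lemma sum_cos_grid:
  assumes "0 < m" "m < 2 * (n + 1)"
  shows "(\<Sum>k<n. cos (real (Suc k) * (real m * pi / (real n + 1)))) = - (1 + (- 1) ^ m) / 2"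
proof -
  define x where "x = real m * pi / (real n + 1)"
  have "real m < 2 * (real n + 1)"
    using of_nat_less_iff[of m "2 * (n + 1)", where 'a = real] assms(2) by simp
  then have "real m * pi < 2 * (real n + 1) * pi"
    by (intro mult_strict_right_mono) auto
  then have "0 < x" "x / 2 < pi"
    using assms(1) by (auto simp: x_def field_simps)
  then have pos: "0 < sin (x / 2)"
    by (intro sin_gt_zero) auto
  have "(real n + 1/2) * x = real m * pi - x / 2"
    by (simp add: x_def field_simps)
  then have "sin ((real n + 1/2) * x) = - ((- 1) ^ m * sin (x / 2))"
    by (simp add: sin_diff)
  with dirichlet_kernel_sum[of x n]
  have "sin (x / 2) * (2 * (\<Sum>k<n. cos (real (Suc k) * x)) + (1 + (- 1) ^ m)) = 0"
    by (simp add: algebra_simps)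
  with pos show ?thesis
    unfolding x_def by simp
qed

text \<open>The product of sines is a difference of cosines at the frequencies
  \<open>|i - j|\<close> and \<open>i + j + 2\<close>. These have the same parity, so their grid
  sums cancel unless \<open>i = j\<close>, where the first sum is \<open>n\<close> and the second is
  -1.\<close>

lemma S_mat_mult_S_mat [simp]: "S_mat n * S_mat n = 1\<^sub>m n"
proof (rule eq_matI)
  fix i j
  assume "i < dim_row (1\<^sub>m n :: real mat)" "j < dim_col (1\<^sub>m n :: real mat)"
  then have ij: "i < n" "j < n"
    by auto
  define d where "d = (if i \<le> j then j - i else i - j)"
  let ?C = "\<lambda>m. \<Sum>k<n. cos (real (Suc k) * (real m * pi / (real n + 1)))"
  have prod: "sin (real (Suc i) * real (Suc k) * pi / (real n + 1)) *
        sin (real (Suc k) * real (Suc j) * pi / (real n + 1)) =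
      (cos (real (Suc k) * (real d * pi / (real n + 1))) -
       cos (real (Suc k) * (real (i + j + 2) * pi / (real n + 1)))) / 2" for k
  proof -
    have "real (Suc i) * real (Suc k) * pi / (real n + 1) + real (Suc k) * real (Suc j) * pi / (real n + 1)
        = real (Suc k) * (real (i + j + 2) * pi / (real n + 1))"
      by (simp add: algebra_simps add_divide_distrib)
    moreover have "cos (real (Suc i) * real (Suc k) * pi / (real n + 1)
          - real (Suc k) * real (Suc j) * pi / (real n + 1))
        = cos (real (Suc k) * (real d * pi / (real n + 1)))"
    proof (cases "i \<le> j")
      case True
      then have "real (Suc i) * real (Suc k) * pi / (real n + 1)
          - real (Suc k) * real (Suc j) * pi / (real n + 1) =
          - (real (Suc k) * (real d * pi / (real n + 1)))"
        by (simp add: d_def of_nat_diff algebra_simps add_divide_distrib diff_divide_distrib)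
      then show ?thesis
        by (simp only: cos_minus)
    next
      case False
      then show ?thesis
        by (intro arg_cong[where f = cos])
          (simp add: d_def of_nat_diff algebra_simps add_divide_distrib diff_divide_distrib)
    qed
    ultimately show ?thesis
      unfolding sin_times_sin by simp
  qed
  have "(S_mat n * S_mat n) $$ (i, j) = (\<Sum>k<n. 2 / (real n + 1) *
      (sin (real (Suc i) * real (Suc k) * pi / (real n + 1)) *
        sin (real (Suc k) * real (Suc j) * pi / (real n + 1))))"
  proof -
    define c where "c = sqrt (2 / (real n + 1))"
    have c: "c * c = 2 / (real n + 1)"
      by (simp add: c_def)
    have "(S_mat n * S_mat n) $$ (i, j) = (\<Sum>k<n. S_mat n $$ (i, k) * S_mat n $$ (k, j))"
      using ij carrier_matD[OF S_mat_carrier[of n]] by (simp add: scalar_prod_def lessThan_atLeast0)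
    also have "\<dots> = (\<Sum>k<n. c * c *
      (sin (real (Suc i) * real (Suc k) * pi / (real n + 1)) *
        sin (real (Suc k) * real (Suc j) * pi / (real n + 1))))"
      using ij by (intro sum.cong refl) (simp add: S_mat_def mult_ac del: of_nat_Suc flip: c_def)
    finally show ?thesis
      by (simp only: c)
  qed
  also have "\<dots> = 2 / (real n + 1) * ((?C d - ?C (i + j + 2)) / 2)"
    unfolding prod by (simp only: sum_distrib_left[symmetric] sum_divide_distrib[symmetric] sum_subtractf)
  also have "?C (i + j + 2) = - (1 + (- 1) ^ (i + j + 2)) / 2"
    using ij by (intro sum_cos_grid) auto
  also have "2 / (real n + 1) * ((?C d - - (1 + (- 1) ^ (i + j + 2)) / 2) / 2) = 1\<^sub>m n $$ (i, j)"
  proof (cases "i = j")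
    case True
    then show ?thesis
      using ij by (simp add: d_def field_simps)
  next
    case False
    then have "?C d = - (1 + (- 1) ^ d) / 2"
      using ij by (intro sum_cos_grid) (auto simp: d_def)
    moreover have "(- 1 :: real) ^ d = (- 1) ^ (i + j + 2)"
      by (auto simp: d_def minus_one_power_iff)
    ultimately show ?thesis
      using ij False by simp
  qed
  finally show "(S_mat n * S_mat n) $$ (i, j) = 1\<^sub>m n $$ (i, j)" .
qed (auto simp: S_mat_def)

section \<open>Toeplitz and Hankel parts\<close>

definition sym_toeplitz :: "nat \<Rightarrow> (nat \<Rightarrow> real) \<Rightarrow> real mat" where
  "sym_toeplitz n t = Matrix.mat n n (\<lambda>(i, j). t (if i \<le> j then j - i else i - j))"

text \<open>The Hankel correction \<open>T - \<tau>(T)\<close> of the symmetric Toeplitz matrix \<open>T\<close>.\<close>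

definition hankel_part :: "nat \<Rightarrow> (nat \<Rightarrow> real) \<Rightarrow> real mat" where
  "hankel_part n t = Matrix.mat n n
     (\<lambda>(i, j). \<Sum>p = 1..<n. t p * (of_bool (i + j + 2 = p) + of_bool (i + j + p = 2 * n)))"

lemma sym_toeplitz_carrier [simp]: "sym_toeplitz n t \<in> carrier_mat n n"
  and hankel_part_carrier [simp]: "hankel_part n t \<in> carrier_mat n n"
  by (simp_all add: sym_toeplitz_def hankel_part_def)

lemma sum_of_bool_single:
  fixes f :: "nat \<Rightarrow> real"
  assumes "finite A" "\<And>m. m \<in> A \<Longrightarrow> P m \<longleftrightarrow> m = a \<and> Q" "Q \<Longrightarrow> a \<in> A"
  shows "(\<Sum>m\<in>A. of_bool (P m) * f m) = (if Q then f a else 0)"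
proof -
  have "(\<Sum>m\<in>A. of_bool (P m) * f m) = (\<Sum>m\<in>A. if m = a then (if Q then f a else 0) else 0)"
    using assms(2) by (intro sum.cong) auto
  also have "\<dots> = (if Q then f a else 0)"
    using assms(1,3) by auto
  finally show ?thesis .
qed

lemma sum_reflected:
  fixes f :: "nat \<Rightarrow> real"
  assumes "i < n" "p < n"
  shows "(\<Sum>m<n. of_bool (m = i + p) * f m) = (if i + p < n then f (i + p) else 0)"
    and "(\<Sum>m<n. of_bool (i = m + p) * f m) = (if p \<le> i then f (i - p) else 0)"
    and "(\<Sum>m<n. of_bool (i + m + 2 = p) * f m) = (if i + 2 \<le> p then f (p - i - 2) else 0)"
    and "(\<Sum>m<n. of_bool (i + m + p = 2 * n) * f m) = (if n < i + p then f (2 * n - i - p) else 0)"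
  using assms by (intro sum_of_bool_single; auto)+

lemma sym_toeplitz_expand:
  assumes "i < n" "j < n"
  shows "sym_toeplitz n t $$ (i, j) = t 0 * of_bool (i = j)
    + (\<Sum>p = 1..<n. t p * (of_bool (j = i + p) + of_bool (i = j + p)))"
proof -
  have "(\<Sum>p = 1..<n. of_bool (j = i + p) * t p) = (if i < j then t (j - i) else 0)"
    using assms by (intro sum_of_bool_single) auto
  moreover have "(\<Sum>p = 1..<n. of_bool (i = j + p) * t p) = (if j < i then t (i - j) else 0)"
    using assms by (intro sum_of_bool_single) auto
  ultimately show ?thesis
    using assms by (auto simp: sym_toeplitz_def distrib_left sum.distrib mult.commute)
qed

lemma hankel_part_index:
  assumes "i < n" "j < n"
  shows "hankel_part n t $$ (i, j) = (if i + j + 2 < n then t (i + j + 2) else 0)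
    + (if n < i + j then t (2 * n - i - j) else 0)"
proof -
  have "(\<Sum>p = 1..<n. of_bool (i + j + 2 = p) * t p) = (if i + j + 2 < n then t (i + j + 2) else 0)"
    by (intro sum_of_bool_single) auto
  moreover have "(\<Sum>p = 1..<n. of_bool (i + j + p = 2 * n) * t p) =
      (if n < i + j then t (2 * n - i - j) else 0)"
    using assms by (intro sum_of_bool_single) auto
  ultimately show ?thesis
    using assms by (simp add: hankel_part_def distrib_left sum.distrib mult.commute)
qed

text \<open>At the nodes \<open>k \<pi> / (n + 1)\<close>, the terms \<open>sin ((i + 1 \<plusminus> p) x)\<close> with \<open>i + 1 \<plusminus> p\<close> out of range
  are reflected back into range.\<close>

lemma sum_reflected_sin:
  assumes "i < n" "p < n" "x = real k * pi / (real n + 1)"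
  shows "(\<Sum>m<n. (of_bool (m = i + p) + of_bool (i = m + p)
      - (of_bool (i + m + 2 = p) + of_bool (i + m + p = 2 * n))) * sin (real (Suc m) * x))
    = 2 * cos (real p * x) * sin (real (Suc i) * x)"
proof -
  let ?f = "\<lambda>m. sin (real (Suc m) * x)"
  have x: "(real n + 1) * x = real k * pi"
    using assms(3) by (simp add: field_simps)
  have up: "(if i + p < n then ?f (i + p) else 0) - (if n < i + p then ?f (2 * n - i - p) else 0)
      = sin (real (Suc i) * x + real p * x)"
  proof -
    consider "i + p < n" | "i + p = n" | "n < i + p"
      by linarith
    then show ?thesis
    proof cases
      case 1
      then show ?thesis by (simp add: algebra_simps)
    next
      case 2
      \<comment> \<open>In one-based counting the target index is \<open>n + 1\<close>, where the
        sine vanishes; both terms on the left are zero.\<close>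
      then have "real (Suc i) * x + real p * x = real k * pi"
        unfolding x[symmetric] by (simp add: algebra_simps flip: 2)
      then show ?thesis
        using 2 by simp
    next
      case 3
      \<comment> \<open>Reflection at the one-based index \<open>n + 1\<close> changes the sign of
        the sine, which the minus sign of the Hankel term compensates.\<close>
      have "real (Suc (2 * n - i - p)) = 2 * (real n + 1) - (real (Suc i) + real p)"
        using assms(1,2) by (simp add: of_nat_diff)
      then have "real (Suc (2 * n - i - p)) * x = 2 * ((real n + 1) * x) - (real (Suc i) * x + real p * x)"
        by (simp only: left_diff_distrib distrib_right mult.assoc)
      also have "2 * ((real n + 1) * x) = real (2 * k) * pi"
        unfolding x by simp
      finally have "real (Suc (2 * n - i - p)) * x = real (2 * k) * pi - (real (Suc i) * x + real p * x)" .
      then have "?f (2 * n - i - p) = - sin (real (Suc i) * x + real p * x)"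
        by (simp only: sin_diff sin_npi cos_npi) simp
      then show ?thesis
        using 3 by simp
    qed
  qed
  have down: "(if p \<le> i then ?f (i - p) else 0) - (if i + 2 \<le> p then ?f (p - i - 2) else 0)
      = sin (real (Suc i) * x - real p * x)"
  proof -
    consider "p \<le> i" | "p = i + 1" | "i + 2 \<le> p"
      by linarith
    then show ?thesis
    proof cases
      case 1
      then show ?thesis by (simp add: of_nat_diff algebra_simps)
    next
      case 2
      then show ?thesis by simp
    next
      case 3
      have "real (Suc (p - i - 2)) * x = - (real (Suc i) * x - real p * x)"
        using 3 by (simp add: of_nat_diff algebra_simps)
      then have "?f (p - i - 2) = - sin (real (Suc i) * x - real p * x)"
        by (simp only: sin_minus)
      then show ?thesis
        using 3 by simp
    qed
  qed
  have "(\<Sum>m<n. (of_bool (m = i + p) + of_bool (i = m + p)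
      - (of_bool (i + m + 2 = p) + of_bool (i + m + p = 2 * n))) * ?f m)
    = sin (real (Suc i) * x + real p * x) + sin (real (Suc i) * x - real p * x)"
    unfolding up[symmetric] down[symmetric] distrib_right left_diff_distrib sum.distrib sum_subtractf
    unfolding sum_reflected[OF assms(1,2)] by simp
  also have "\<dots> = 2 * cos (real p * x) * sin (real (Suc i) * x)"
    by (simp add: sin_add sin_diff)
  finally show ?thesis .
qed

lemma tau_eigval_sym_toeplitz:
  assumes "0 < n"
  shows "tau_eigval (sym_toeplitz n t) k =
    t 0 + 2 * (\<Sum>p = 1..<n. t p * cos (real p * (real k * pi / (real n + 1))))"
proof -
  have "(\<Sum>j = 1..<n. sym_toeplitz n t $$ (j, 0) * cos (real j * real k * pi / (real n + 1))) =
      (\<Sum>p = 1..<n. t p * cos (real p * (real k * pi / (real n + 1))))"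
    by (intro sum.cong) (auto simp: sym_toeplitz_def mult.assoc)
  then show ?thesis
    using assms by (simp add: tau_eigval_def) (simp add: sym_toeplitz_def)
qed

text \<open>The columns of \<open>S_mat n\<close> are sampled sines, on which the corrected shift by
  \<open>p\<close> acts as multiplication by \<open>2 cos (p x)\<close>. Weighted by
  \<open>t p\<close>, these factors add up to the eigenvalue.\<close>

lemma toeplitz_minus_hankel_mult_S_mat:
  "(sym_toeplitz n t - hankel_part n t) * S_mat n =
     S_mat n * mat_diag n (\<lambda>k. tau_eigval (sym_toeplitz n t) (Suc k))"
proof (rule eq_matI)
  fix i k
  assume "i < dim_row (S_mat n * mat_diag n (\<lambda>k. tau_eigval (sym_toeplitz n t) (Suc k)))"
    "k < dim_col (S_mat n * mat_diag n (\<lambda>k. tau_eigval (sym_toeplitz n t) (Suc k)))"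
  then have ik: "i < n" "k < n"
    by (auto simp: S_mat_def mat_diag_def)
  define x where "x = real (Suc k) * pi / (real n + 1)"
  define c where "c = sqrt (2 / (real n + 1))"
  \<comment> \<open>\<open>u p\<close> is row \<open>i\<close> of the symmetric shift by
    \<open>p\<close> minus its reflections, so that the matrix is linear in
    \<open>t\<close>.\<close>
  define u :: "nat \<Rightarrow> nat \<Rightarrow> real" where
    "u p m = of_bool (m = i + p) + of_bool (i = m + p)
      - (of_bool (i + m + 2 = p) + of_bool (i + m + p = 2 * n))" for p m
  have S: "S_mat n $$ (m, k) = c * sin (real (Suc m) * x)" if "m < n" for m
    using that ik by (simp add: S_mat_def c_def x_def mult.assoc)
  have "((sym_toeplitz n t - hankel_part n t) * S_mat n) $$ (i, k) =
      (\<Sum>m<n. (sym_toeplitz n t $$ (i, m) - hankel_part n t $$ (i, m)) * S_mat n $$ (m, k))"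
    using ik carrier_matD[OF hankel_part_carrier[of n t]] carrier_matD[OF S_mat_carrier[of n]]
    by (auto simp: scalar_prod_def lessThan_atLeast0 intro!: sum.cong)
  also have "\<dots> = (\<Sum>m<n. (t 0 * of_bool (i = m) + (\<Sum>p = 1..<n. t p * u p m))
      * (c * sin (real (Suc m) * x)))"
    using ik by (intro sum.cong refl arg_cong2[where f = "(*)"])
      (auto simp: S u_def sym_toeplitz_expand hankel_part_def right_diff_distrib sum_subtractf)
  also have "\<dots> = c * (t 0 * sin (real (Suc i) * x)) +
      c * (\<Sum>m<n. \<Sum>p = 1..<n. t p * (u p m * sin (real (Suc m) * x)))"
  proof -
    have "(\<Sum>m<n. of_bool (i = m) * (t 0 * (c * sin (real (Suc m) * x)))) =
        (if True then t 0 * (c * sin (real (Suc i) * x)) else 0)"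
      using ik by (intro sum_of_bool_single) auto
    then show ?thesis
      by (simp add: distrib_left distrib_right sum.distrib sum_distrib_left sum_distrib_right mult_ac
          del: of_nat_Suc)
  qed
  also have "(\<Sum>m<n. \<Sum>p = 1..<n. t p * (u p m * sin (real (Suc m) * x))) =
      (\<Sum>p = 1..<n. t p * (\<Sum>m<n. u p m * sin (real (Suc m) * x)))"
    by (subst sum.swap) (simp only: sum_distrib_left)
  also have "\<dots> = (\<Sum>p = 1..<n. t p * (2 * cos (real p * x) * sin (real (Suc i) * x)))"
    unfolding u_def using ik
    by (intro sum.cong refl arg_cong2[where f = "(*)"] sum_reflected_sin[where k = "Suc k"])
      (auto simp: x_def)
  also have "c * (t 0 * sin (real (Suc i) * x)) + c * \<dots> =
      S_mat n $$ (i, k) * tau_eigval (sym_toeplitz n t) (Suc k)"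
    using ik unfolding S[OF ik(1)]
    by (simp add: tau_eigval_sym_toeplitz x_def algebra_simps sum_distrib_left del: of_nat_Suc)
  also have "\<dots> = (S_mat n * mat_diag n (\<lambda>k. tau_eigval (sym_toeplitz n t) (Suc k))) $$ (i, k)"
    using ik by (simp add: mat_diag_mult_right[OF S_mat_carrier])
  finally show "((sym_toeplitz n t - hankel_part n t) * S_mat n) $$ (i, k) =
      (S_mat n * mat_diag n (\<lambda>k. tau_eigval (sym_toeplitz n t) (Suc k))) $$ (i, k)" .
qed (auto simp: S_mat_def mat_diag_def sym_toeplitz_def hankel_part_def)

text \<open>Removes the trigonometry: from here on the comparison of a Toeplitz matrix with its
  \<tau> matrix is a matter of entries.\<close>

lemma tau_mat_sym_toeplitz:
  "tau_mat (sym_toeplitz n t) = sym_toeplitz n t - hankel_part n t"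
proof -
  have c: "sym_toeplitz n t - hankel_part n t \<in> carrier_mat n n"
    by (intro minus_carrier_mat) simp
  have "tau_mat (sym_toeplitz n t) = (sym_toeplitz n t - hankel_part n t) * S_mat n * S_mat n"
    unfolding toeplitz_minus_hankel_mult_S_mat
    by (simp add: tau_mat_def carrier_matD[OF sym_toeplitz_carrier])
  also have "\<dots> = (sym_toeplitz n t - hankel_part n t) * (S_mat n * S_mat n)"
    by (rule assoc_mult_mat[OF c S_mat_carrier S_mat_carrier])
  also have "\<dots> = sym_toeplitz n t - hankel_part n t"
    by (simp add: right_mult_one_mat[OF c])
  finally show ?thesis .
qed

lemma tau_mat_carrier [simp]: "A \<in> carrier_mat n n \<Longrightarrow> tau_mat A \<in> carrier_mat n n"
  by (auto simp: tau_mat_def S_mat_def mat_diag_def)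

section \<open>The one-dimensional bounds\<close>

text \<open>A shift and its reflection at the same end exclude each other, so each of the two ends
  contributes at most 1.\<close>

lemma sum_reflected_le:
  fixes i n p :: nat
  assumes "i < n" "p \<in> {1..<n}"
  shows "(\<Sum>m<n. of_bool (m = i + p) + of_bool (i = m + p)
      + (of_bool (i + m + 2 = p) + of_bool (i + m + p = 2 * n))) \<le> (2::real)"
proof -
  have "p < n"
    using assms(2) by simp
  note s = sum_reflected[OF assms(1) this, of "\<lambda>_. 1", unfolded mult_1_right]
  show ?thesis
    unfolding sum.distrib s by simp
qed

text \<open>Diagonal dominance for all \<open>c\<close> at once. Every row is compared with the case
  \<open>c = 1\<close>, where the off-diagonal entries are all nonpositive and their absolute values
  add without loss.\<close>

lemma toeplitz_hankel_spd:
  assumes nonpos: "\<And>p. 1 \<le> p \<Longrightarrow> t p \<le> 0"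
    and mono: "\<And>p. 1 \<le> p \<Longrightarrow> t p \<le> t (Suc p)"
    and pos: "0 < t 0 + 2 * (\<Sum>p = 1..<n. t p)"
    and c: "- 3 \<le> c" "c \<le> 1"
  shows "spd_mat (sym_toeplitz n t + c \<cdot>\<^sub>m hankel_part n t)"
proof (rule diag_dominant_spd)
  let ?T = "\<lambda>i j. sym_toeplitz n t $$ (i, j)" and ?H = "\<lambda>i j. hankel_part n t $$ (i, j)"
  let ?M = "sym_toeplitz n t + c \<cdot>\<^sub>m hankel_part n t"
  show "?M \<in> carrier_mat n n"
    by simp
  have M: "?M $$ (i, j) = ?T i j + c * ?H i j" if "i < n" "j < n" for i j
    using that carrier_matD[OF hankel_part_carrier[of n t]] by simp
  show "?M $$ (i, j) = ?M $$ (j, i)" if "i < n" "j < n" for i j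
    unfolding M[OF that] M[OF that(2,1)]
    using that by (auto simp: sym_toeplitz_def hankel_part_index add.commute)
  have mono': "t p \<le> t q" if "1 \<le> p" "p \<le> q" for p q
    using that(2)
  proof (induction q rule: dec_induct)
    case (step q)
    then show ?case
      using mono[of q] that(1) by linarith
  qed simp
  fix i
  assume i: "i < n"
  have H_nonpos: "?H i j \<le> 0" if "j < n" for j
    using i that by (auto simp: hankel_part_index intro!: add_nonpos_nonpos nonpos)
  have T_le_H: "?T i j \<le> ?H i j" if "j < n" "i \<noteq> j" for j
    using i that
    by (auto simp: hankel_part_index sym_toeplitz_def intro!: mono' nonpos)
  \<comment> \<open>At \<open>c = 1\<close> this is an equality; at \<open>c = -3\<close> the upper
    estimate is exactly \<open>?T i j <= ?H i j\<close>. This fixes the range of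
    \<open>c\<close>.\<close>
  have le: "\<bar>?M $$ (i, j)\<bar> \<le> - ?T i j - ?H i j" if "j < n" "i \<noteq> j" for j
  proof -
    have "c * ?H i j \<le> - 3 * ?H i j" "1 * ?H i j \<le> c * ?H i j"
      using c H_nonpos[OF that(1)] by (intro mult_right_mono_neg; simp)+
    then show ?thesis
      using T_le_H[OF that] H_nonpos[OF that(1)] M[OF i that(1)] by linarith
  qed
  define w v :: "nat \<Rightarrow> nat \<Rightarrow> real"
    where "w p j = of_bool (j = i + p) + of_bool (i = j + p)"
      and "v p j = of_bool (i + j + 2 = p) + of_bool (i + j + p = 2 * n)" for p j
  have "(\<Sum>j\<in>{..<n} - {i}. - ?T i j) = (\<Sum>j<n. - (\<Sum>p = 1..<n. t p * w p j))"
    using i by (intro sum.mono_neutral_cong_left) (auto simp: sym_toeplitz_expand w_def)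
  \<comment> \<open>The bound on reflections needs the whole row, including the diagonal Hankel
    entry. The resulting \<open>?H i i\<close> is absorbed at the end, since it is at most
    \<open>c * ?H i i\<close>.\<close>
  moreover have "(\<Sum>j\<in>{..<n} - {i}. - ?H i j) = (\<Sum>j<n. - ?H i j) + ?H i i"
    using i by (simp add: sum.remove[of "{..<n}" i])
  moreover have "(\<Sum>j<n. - ?H i j) = (\<Sum>j<n. - (\<Sum>p = 1..<n. t p * v p j))"
    using i by (intro sum.cong) (auto simp: hankel_part_def v_def)
  ultimately have "(\<Sum>j\<in>{..<n} - {i}. - ?T i j - ?H i j) =
      (\<Sum>j<n. - (\<Sum>p = 1..<n. t p * w p j)) + (\<Sum>j<n. - (\<Sum>p = 1..<n. t p * v p j)) + ?H i i"
    by (simp only: diff_conv_add_uminus sum.distrib add.assoc)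
  also have "(\<Sum>j<n. - (\<Sum>p = 1..<n. t p * w p j)) + (\<Sum>j<n. - (\<Sum>p = 1..<n. t p * v p j)) =
      (\<Sum>j<n. \<Sum>p = 1..<n. - t p * (w p j + v p j))"
    by (simp add: sum_negf sum.distrib sum_subtractf distrib_left)
  also have "\<dots> = (\<Sum>p = 1..<n. - t p * (\<Sum>j<n. w p j + v p j))"
    by (subst sum.swap) (simp only: sum_distrib_left)
  also have "\<dots> \<le> (\<Sum>p = 1..<n. - t p * 2)"
    using nonpos i unfolding w_def v_def by (intro sum_mono mult_left_mono sum_reflected_le) auto
  also have "\<dots> < t 0"
    using pos by (simp add: sum_negf flip: sum_distrib_right)
  finally have "(\<Sum>j\<in>{..<n} - {i}. - ?T i j - ?H i j) < t 0 + ?H i i"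
    by simp
  also have "\<dots> \<le> ?M $$ (i, i)"
  proof -
    have "1 * ?H i i \<le> c * ?H i i"
      using c H_nonpos[OF i] by (intro mult_right_mono_neg; simp)
    then show ?thesis
      using M[OF i i] i by (simp add: sym_toeplitz_def)
  qed
  finally show "(\<Sum>j\<in>{..<n} - {i}. \<bar>?M $$ (i, j)\<bar>) < ?M $$ (i, i)"
    using sum_mono[of "{..<n} - {i}" "\<lambda>j. \<bar>?M $$ (i, j)\<bar>" "\<lambda>j. - ?T i j - ?H i j"] le
    by auto
qed

lemma sym_part_carrier [simp]: "Z \<in> carrier_mat n n \<Longrightarrow> sym_part Z \<in> carrier_mat n n"
  by (auto simp: sym_part_def)

lemma sym_part_index:
  "Z \<in> carrier_mat n n \<Longrightarrow> i < n \<Longrightarrow> j < n \<Longrightarrow> sym_part Z $$ (i, j) = (Z $$ (i, j) + Z $$ (j, i)) / 2"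
  by (auto simp: sym_part_def)

lemma B_mat_carrier [simp]: "B_mat kp km n \<delta> \<in> carrier_mat n n"
  by (auto simp: B_mat_def T_mat_def)

text \<open>\<open>T_mat\<close> and its transpose have the same symmetric part, so unequal
  \<open>kp\<close> and \<open>km\<close> enter only through their sum.\<close>

lemma sym_part_B_mat:
  "sym_part (B_mat kp km n \<delta>) = sym_toeplitz n (\<lambda>p. (kp + km) / 2 * sym_coeff \<delta> p)"
proof (rule eq_matI)
  fix i j
  assume "i < dim_row (sym_toeplitz n (\<lambda>p. (kp + km) / 2 * sym_coeff \<delta> p))"
    "j < dim_col (sym_toeplitz n (\<lambda>p. (kp + km) / 2 * sym_coeff \<delta> p))"
  then have ij: "i < n" "j < n"
    by (auto simp: sym_toeplitz_def)
  have T: "T_mat n \<delta> $$ (i, j) + T_mat n \<delta> $$ (j, i) = sym_coeff \<delta> (if i \<le> j then j - i else i - j)"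
  proof -
    consider "i = j" | "j = i + 1" | "i = j + 1" | "j > i + 1" | "i > j + 1"
      by linarith
    then show ?thesis
      using ij by cases (auto simp: T_mat_def sym_coeff_def Suc_diff_le numeral_2_eq_2 simp del: q_coeff.simps)
  qed
  have "sym_part (B_mat kp km n \<delta>) $$ (i, j) =
      (kp + km) / 2 * (T_mat n \<delta> $$ (i, j) + T_mat n \<delta> $$ (j, i))"
    using ij by (subst sym_part_index[of _ n]) (auto simp: B_mat_def T_mat_def field_simps)
  then show "sym_part (B_mat kp km n \<delta>) $$ (i, j) =
      sym_toeplitz n (\<lambda>p. (kp + km) / 2 * sym_coeff \<delta> p) $$ (i, j)"
    using ij unfolding T by (simp add: sym_toeplitz_def)
qed (auto simp: sym_part_def B_mat_def T_mat_def sym_toeplitz_def)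

lemma A_mat_eq_sym_toeplitz:
  "A_mat n = sym_toeplitz n (\<lambda>p. if p = 0 then 6/8 else if p = 1 then 1/8 else 0)"
  by (rule eq_matI) (auto simp: A_mat_def sym_toeplitz_def)

lemma A_mat_carrier [simp]: "A_mat n \<in> carrier_mat n n"
  by (simp add: A_mat_def)

text \<open>The Hankel part only involves coefficients of index at least 2, which vanish for a
  tridiagonal matrix.\<close>

lemma tau_A_mat: "tau_mat (A_mat n) = A_mat n"
  unfolding A_mat_eq_sym_toeplitz tau_mat_sym_toeplitz
  using carrier_matD[OF hankel_part_carrier[of n]]
  by (intro eq_matI) (auto simp: hankel_part_index sym_toeplitz_def)

lemma spd_A_mat: "spd_mat (A_mat n)"
proof (rule diag_dominant_spd)
  show "A_mat n $$ (i, j) = A_mat n $$ (j, i)" if "i < n" "j < n" for i j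
    using that by (auto simp: A_mat_def)
  fix i
  assume i: "i < n"
  have "(\<Sum>j\<in>{..<n} - {i}. \<bar>A_mat n $$ (i, j)\<bar>) \<le>
      (\<Sum>j\<in>{..<n} - {i}. of_bool (j = i + 1) * (1/8) + of_bool (i = j + 1) * (1/8))"
    using i by (intro sum_mono) (auto simp: A_mat_def)
  also have "\<dots> \<le> (\<Sum>j<n. of_bool (j = i + 1) * (1/8) + of_bool (i = j + 1) * (1/8))"
    by (intro sum_mono2) auto
  also have "\<dots> = (if i + 1 < n then 1/8 else 0) + (if 1 \<le> i then 1/8 else 0)"
  proof -
    have "(\<Sum>j<n. of_bool (j = i + 1) * (1/8 :: real)) = (if i + 1 < n then 1/8 else 0)"
      by (rule sum_of_bool_single[where a = "i + 1"]) auto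
    moreover have "(\<Sum>j<n. of_bool (i = j + 1) * (1/8 :: real)) = (if 1 \<le> i then 1/8 else 0)"
      by (rule sum_of_bool_single[where a = "i - 1"]) (use i in auto)
    ultimately show ?thesis
      by (simp add: sum.distrib)
  qed
  also have "\<dots> < A_mat n $$ (i, i)"
    using i by (simp add: A_mat_def)
  finally show "(\<Sum>j\<in>{..<n} - {i}. \<bar>A_mat n $$ (i, j)\<bar>) < A_mat n $$ (i, i)" .
qed simp

text \<open>For \<open>H = sym_part (B_mat kp km n \<delta>)\<close>, the pairs \<open>(1, -1/2)\<close> and \<open>(-1, 3/2)\<close> of coefficients
  give \<open>\<tau>(H)/2 < H < 3\<tau>(H)/2\<close>, and \<open>(0, 1)\<close> gives \<open>0 < \<tau>(H)\<close>.\<close>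

lemma sym_part_B_mat_tau_spd:
  assumes "0 < \<delta>" "\<delta> < 1" "0 < kp" "0 < km"
    and c: "0 < c + d" "d \<le> 3 * (c + d)" "- d \<le> c + d"
  shows "spd_mat (c \<cdot>\<^sub>m sym_part (B_mat kp km n \<delta>) + d \<cdot>\<^sub>m tau_mat (sym_part (B_mat kp km n \<delta>)))"
proof -
  define t where "t p = (kp + km) / 2 * sym_coeff \<delta> p" for p
  \<comment> \<open>Since \<tau> is Toeplitz minus Hankel, the combination is \<open>c + d\<close>
    times this matrix; the last two hypotheses on \<open>c\<close> and \<open>d\<close> say that the
    Hankel coefficient lies between -3 and 1.\<close>
  have "spd_mat (sym_toeplitz n t + (- d / (c + d)) \<cdot>\<^sub>m hankel_part n t)"
  proof (rule toeplitz_hankel_spd)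
    show "t p \<le> 0" if "1 \<le> p" for p
      using sym_coeff_nonpos[OF assms(1,2) that] assms(3,4) unfolding t_def
      by (intro mult_nonneg_nonpos) auto
    show "t p \<le> t (Suc p)" if "1 \<le> p" for p
      using sym_coeff_le_Suc[OF assms(1,2) that] assms(3,4) unfolding t_def
      by (intro mult_left_mono) auto
    have "0 < (kp + km) / 2 * (sym_coeff \<delta> 0 + 2 * (\<Sum>p = 1..<n. sym_coeff \<delta> p))"
      using sym_coeff_sum_pos[OF assms(1,2), of n] assms(3,4) by (intro mult_pos_pos) auto
    then show "0 < t 0 + 2 * (\<Sum>p = 1..<n. t p)"
      unfolding t_def by (simp add: sum_distrib_left distrib_left mult_ac)
    show "- 3 \<le> - d / (c + d)" "- d / (c + d) \<le> 1"
      using c by (auto simp: field_simps)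
  qed
  then have "spd_mat ((c + d) \<cdot>\<^sub>m (sym_toeplitz n t + (- d / (c + d)) \<cdot>\<^sub>m hankel_part n t))"
    using c(1) by (rule spd_mat_smult[where n = n]) simp
  also have "(c + d) \<cdot>\<^sub>m (sym_toeplitz n t + (- d / (c + d)) \<cdot>\<^sub>m hankel_part n t) =
      c \<cdot>\<^sub>m sym_toeplitz n t + d \<cdot>\<^sub>m (sym_toeplitz n t - hankel_part n t)"
    using c(1) by (intro eq_matI) (auto simp: sym_toeplitz_def hankel_part_def field_simps)
  also have "\<dots> = c \<cdot>\<^sub>m sym_part (B_mat kp km n \<delta>) + d \<cdot>\<^sub>m tau_mat (sym_part (B_mat kp km n \<delta>))"
    unfolding sym_part_B_mat tau_mat_sym_toeplitz by (simp add: t_def[abs_def])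
  finally show ?thesis .
qed

section \<open>Square roots of diagonalized matrices\<close>

lemma transpose_kron:
  "transpose_mat (A \<otimes>\<^sub>K B) = transpose_mat A \<otimes>\<^sub>K transpose_mat B"
  by (rule eq_matI) (auto simp: kron_def div_mod_less_mult)

lemma kron_mult:
  assumes A: "A \<in> carrier_mat l m" and B: "B \<in> carrier_mat l' m'"
    and C: "C \<in> carrier_mat m n" and D: "D \<in> carrier_mat m' n'"
  shows "(A \<otimes>\<^sub>K B) * (C \<otimes>\<^sub>K D) = (A * C) \<otimes>\<^sub>K (B * D)"
proof (rule eq_matI)
  note AB = kron_carrier[OF A B] and CD = kron_carrier[OF C D]
  have AC: "A * C \<in> carrier_mat l n" and BD: "B * D \<in> carrier_mat l' n'"
    using assms by auto
  note ACBD = kron_carrier[OF AC BD]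
  fix i j
  assume "i < dim_row ((A * C) \<otimes>\<^sub>K (B * D))" "j < dim_col ((A * C) \<otimes>\<^sub>K (B * D))"
  then have ij: "i < l * l'" "j < n * n'"
    using ACBD by auto
  note ij' = div_mod_less_mult[OF ij(1)] div_mod_less_mult[OF ij(2)]
  have "((A \<otimes>\<^sub>K B) * (C \<otimes>\<^sub>K D)) $$ (i, j) =
      (\<Sum>k<m * m'. (A \<otimes>\<^sub>K B) $$ (i, k) * (C \<otimes>\<^sub>K D) $$ (k, j))"
    using AB CD ij by (simp add: scalar_prod_def lessThan_atLeast0)
  also have "\<dots> = (\<Sum>k<m * m'. (A $$ (i div l', k div m') * B $$ (i mod l', k mod m')) *
      (C $$ (k div m', j div n') * D $$ (k mod m', j mod n')))"
    using ij by (intro sum.cong refl) (simp add: kron_index[OF A B] kron_index[OF C D])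
  also have "\<dots> = (\<Sum>k<m. \<Sum>k'<m'. (A $$ (i div l', k) * B $$ (i mod l', k')) *
      (C $$ (k, j div n') * D $$ (k', j mod n')))"
    by (rule sum_div_mod)
  also have "\<dots> = (\<Sum>k<m. A $$ (i div l', k) * C $$ (k, j div n')) *
      (\<Sum>k'<m'. B $$ (i mod l', k') * D $$ (k', j mod n'))"
    by (simp add: sum_product mult_ac)
  also have "\<dots> = ((A * C) \<otimes>\<^sub>K (B * D)) $$ (i, j)"
    using A B C D ij ij'
    by (simp add: kron_index[OF AC BD] scalar_prod_def lessThan_atLeast0)
  finally show "((A \<otimes>\<^sub>K B) * (C \<otimes>\<^sub>K D)) $$ (i, j) = ((A * C) \<otimes>\<^sub>K (B * D)) $$ (i, j)" .
qed (use assms in \<open>auto simp: kron_def\<close>)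

lemma kron_mat_diag:
  "mat_diag m f \<otimes>\<^sub>K mat_diag n g = mat_diag (m * n) (\<lambda>k. f (k div n) * g (k mod n))"
proof (rule eq_matI)
  fix i j
  assume "i < dim_row (mat_diag (m * n) (\<lambda>k. f (k div n) * g (k mod n)))"
    "j < dim_col (mat_diag (m * n) (\<lambda>k. f (k div n) * g (k mod n)))"
  then have ij: "i < m * n" "j < m * n"
    by (auto simp: mat_diag_def)
  have "(mat_diag m f \<otimes>\<^sub>K mat_diag n g) $$ (i, j) =
      mat_diag m f $$ (i div n, j div n) * mat_diag n g $$ (i mod n, j mod n)"
    by (rule kron_index[OF mat_diag_dim mat_diag_dim ij])
  also have "\<dots> = (if i div n = j div n then f (j div n) else 0) * (if i mod n = j mod n then g (j mod n) else 0)"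
    using div_mod_less_mult[OF ij(1)] div_mod_less_mult[OF ij(2)] by (simp add: mat_diag_def)
  also have "\<dots> = (if i div n = j div n \<and> i mod n = j mod n then f (j div n) * g (j mod n) else 0)"
    by simp
  also have "i div n = j div n \<and> i mod n = j mod n \<longleftrightarrow> i = j"
    by (metis div_mult_mod_eq)
  finally show "(mat_diag m f \<otimes>\<^sub>K mat_diag n g) $$ (i, j) =
      mat_diag (m * n) (\<lambda>k. f (k div n) * g (k mod n)) $$ (i, j)"
    using ij by (simp add: mat_diag_def)
qed (auto simp: kron_def mat_diag_def)

lemma kron_one: "1\<^sub>m m \<otimes>\<^sub>K 1\<^sub>m n = 1\<^sub>m (m * n)"
  using kron_mat_diag[of m "\<lambda>_. 1" n "\<lambda>_. 1"] by simp

text \<open>No inverse appears because the sine matrices are involutions. That property is assumed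
  separately where it is used, so closure under sums, multiples and Kronecker products is pure
  matrix algebra.\<close>

definition diagonalized_by :: "nat \<Rightarrow> real mat \<Rightarrow> real mat \<Rightarrow> bool" where
  "diagonalized_by n S A \<longleftrightarrow> S \<in> carrier_mat n n \<and> (\<exists>f. A = S * mat_diag n f * S)"

lemma diagonalized_by_add:
  assumes "diagonalized_by n S A" "diagonalized_by n S B"
  shows "diagonalized_by n S (A + B)"
proof -
  obtain f g where fg: "A = S * mat_diag n f * S" "B = S * mat_diag n g * S" and S: "S \<in> carrier_mat n n"
    using assms by (auto simp: diagonalized_by_def)
  have "mat_diag n (\<lambda>k. f k + g k) = mat_diag n f + mat_diag n g"
    by (rule eq_matI) (auto simp: mat_diag_def)
  then have "S * mat_diag n (\<lambda>k. f k + g k) * S = (S * mat_diag n f + S * mat_diag n g) * S"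
    using mult_add_distrib_mat[OF S mat_diag_dim mat_diag_dim] by metis
  also have "\<dots> = A + B"
    unfolding fg
    by (rule add_mult_distrib_mat[OF mult_carrier_mat[OF S mat_diag_dim] mult_carrier_mat[OF S mat_diag_dim] S])
  finally have "A + B = S * mat_diag n (\<lambda>k. f k + g k) * S" ..
  then show ?thesis
    unfolding diagonalized_by_def using S by blast
qed

lemma diagonalized_by_smult:
  assumes "diagonalized_by n S A"
  shows "diagonalized_by n S (c \<cdot>\<^sub>m A)"
proof -
  obtain f where f: "A = S * mat_diag n f * S" and S: "S \<in> carrier_mat n n"
    using assms by (auto simp: diagonalized_by_def)
  have "mat_diag n (\<lambda>k. c * f k) = c \<cdot>\<^sub>m mat_diag n f"
    by (rule eq_matI) (auto simp: mat_diag_def)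
  then have "S * mat_diag n (\<lambda>k. c * f k) * S = (c \<cdot>\<^sub>m (S * mat_diag n f)) * S"
    using mult_smult_distrib[OF S mat_diag_dim] by metis
  also have "\<dots> = c \<cdot>\<^sub>m A"
    unfolding f by (rule mult_smult_assoc_mat[OF mult_carrier_mat[OF S mat_diag_dim] S])
  finally have "c \<cdot>\<^sub>m A = S * mat_diag n (\<lambda>k. c * f k) * S" ..
  then show ?thesis
    unfolding diagonalized_by_def using S by blast
qed

lemma diagonalized_by_kron:
  assumes "diagonalized_by m S A" "diagonalized_by n S' B"
  shows "diagonalized_by (m * n) (S \<otimes>\<^sub>K S') (A \<otimes>\<^sub>K B)"
proof -
  obtain f g where fg: "A = S * mat_diag m f * S" "B = S' * mat_diag n g * S'"
    and S: "S \<in> carrier_mat m m" "S' \<in> carrier_mat n n"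
    using assms by (auto simp: diagonalized_by_def)
  have "A \<otimes>\<^sub>K B = ((S * mat_diag m f) \<otimes>\<^sub>K (S' * mat_diag n g)) * (S \<otimes>\<^sub>K S')"
    unfolding fg
    by (rule kron_mult[symmetric, OF mult_carrier_mat[OF S(1) mat_diag_dim]
          mult_carrier_mat[OF S(2) mat_diag_dim] S])
  also have "(S * mat_diag m f) \<otimes>\<^sub>K (S' * mat_diag n g) = (S \<otimes>\<^sub>K S') * (mat_diag m f \<otimes>\<^sub>K mat_diag n g)"
    by (rule kron_mult[symmetric, OF S(1) S(2) mat_diag_dim mat_diag_dim])
  finally have "A \<otimes>\<^sub>K B = (S \<otimes>\<^sub>K S') * mat_diag (m * n) (\<lambda>k. f (k div n) * g (k mod n)) * (S \<otimes>\<^sub>K S')"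
    unfolding kron_mat_diag .
  then show ?thesis
    unfolding diagonalized_by_def using kron_carrier[OF S] by blast
qed

lemma spd_mat_diag_conj:
  assumes S: "S \<in> carrier_mat n n" "transpose_mat S = S" "S * S = 1\<^sub>m n"
    and f: "\<And>k. k < n \<Longrightarrow> 0 < f k"
  shows "spd_mat (S * mat_diag n f * S)"
  unfolding spd_mat_def
proof (intro conjI ballI impI)
  let ?D = "mat_diag n f"
  have D: "transpose_mat ?D = ?D"
    by (rule eq_matI) (auto simp: mat_diag_def)
  have SD: "S * ?D \<in> carrier_mat n n"
    using S by auto
  show "square_mat (S * ?D * S)"
    using S by auto
  have "transpose_mat (S * ?D * S) = S * (?D * S)"
    by (simp add: transpose_mult[OF SD S(1)] transpose_mult[OF S(1) mat_diag_dim] S(2) D)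
  then show "transpose_mat (S * ?D * S) = S * ?D * S"
    using assoc_mult_mat[OF S(1) mat_diag_dim S(1)] by simp
  fix v :: "real vec"
  assume v: "v \<in> carrier_vec (dim_row (S * ?D * S))" "v \<noteq> 0\<^sub>v (dim_row (S * ?D * S))"
  then have v: "v \<in> carrier_vec n" "v \<noteq> 0\<^sub>v n"
    using S by auto
  define w where "w = S *\<^sub>v v"
  have w: "w \<in> carrier_vec n"
    using S v by (auto simp: w_def)
  have "S *\<^sub>v w = v"
    unfolding w_def using S v by (simp flip: assoc_mult_mat_vec[OF S(1) S(1) v(1)])
  then have "w \<noteq> 0\<^sub>v n"
    using S v by auto
  then obtain k where k: "k < n" "w $ k \<noteq> 0"
    using w by (auto simp: vec_eq_iff)
  have "v \<bullet> ((S * ?D * S) *\<^sub>v v) = v \<bullet> (S *\<^sub>v (?D *\<^sub>v w))"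
    unfolding w_def using S v
    by (simp add: assoc_mult_mat_vec[OF SD S(1) v(1)] assoc_mult_mat_vec[OF S(1) mat_diag_dim, of _ f])
  also have "\<dots> = w \<bullet> (?D *\<^sub>v w)"
    using transpose_vec_mult_scalar[OF S(1), of "?D *\<^sub>v w" v] S v w
    by (simp add: w_def mult_mat_vec_carrier[OF mat_diag_dim])
  also have "\<dots> = (\<Sum>i<n. f i * (w $ i)\<^sup>2)"
    unfolding quad_form_sum[OF mat_diag_dim w]
  proof (rule sum.cong[OF refl])
    fix i
    assume "i \<in> {..<n}"
    then have "(\<Sum>j<n. w $ i * ?D $$ (i, j) * w $ j) = (\<Sum>j<n. if j = i then f i * (w $ i)\<^sup>2 else 0)"
      by (intro sum.cong refl) (auto simp: mat_diag_def power2_eq_square)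
    then show "(\<Sum>j<n. w $ i * ?D $$ (i, j) * w $ j) = f i * (w $ i)\<^sup>2"
      using \<open>i \<in> {..<n}\<close> by simp
  qed
  also have "\<dots> > 0"
    by (rule sum_pos2[of _ k]) (use k f in \<open>auto simp: less_imp_le\<close>)
  finally show "0 < v \<bullet> ((S * ?D * S) *\<^sub>v v)" .
qed

lemma col_mult_mat_diag:
  fixes S :: "real mat"
  assumes "S \<in> carrier_mat n n" "k < n"
  shows "col (S * mat_diag n f) k = f k \<cdot>\<^sub>v col S k"
  using assms by (intro eq_vecI) (auto simp: mat_diag_mult_right)

lemma mult_vec_col_conj_diag:
  fixes S :: "real mat"
  assumes S: "S \<in> carrier_mat n n" "S * S = 1\<^sub>m n" and k: "k < n"
  shows "(S * mat_diag n f * S) *\<^sub>v col S k = f k \<cdot>\<^sub>v col S k"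
proof -
  have SD: "S * mat_diag n f \<in> carrier_mat n n"
    using S by auto
  have "(S * mat_diag n f * S) *\<^sub>v col S k = col (S * mat_diag n f * S * S) k"
    using col_mult2[OF mult_carrier_mat[OF SD S(1)] S(1) k] by simp
  also have "S * mat_diag n f * S * S = S * mat_diag n f"
    using assoc_mult_mat[OF SD S(1) S(1)] S(2) right_mult_one_mat[OF SD] by simp
  finally show ?thesis
    using col_mult_mat_diag[OF S(1) k] by simp
qed

text \<open>A positive definite square root \<open>R\<close> of \<open>P\<close> scales each eigenvector \<open>s\<close> of \<open>P\<close>, with
  \<open>P s = \<mu>\<^sup>2 s\<close>, by \<open>\<mu>\<close>: the vector \<open>w = R s - \<mu> s\<close> satisfies \<open>R w = -\<mu> w\<close>.\<close>

lemma spd_root_eigenvector: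
  assumes R: "spd_mat R" "R \<in> carrier_mat n n"
    and s: "s \<in> carrier_vec n" "(R * R) *\<^sub>v s = \<mu>\<^sup>2 \<cdot>\<^sub>v s" and \<mu>: "0 < \<mu>"
  shows "R *\<^sub>v s = \<mu> \<cdot>\<^sub>v s"
proof -
  define w where "w = R *\<^sub>v s - \<mu> \<cdot>\<^sub>v s"
  have Rs: "R *\<^sub>v s \<in> carrier_vec n" and \<mu>s: "\<mu> \<cdot>\<^sub>v s \<in> carrier_vec n" and w: "w \<in> carrier_vec n"
    using R s by (auto simp: w_def)
  have "R *\<^sub>v w = R *\<^sub>v (R *\<^sub>v s) - R *\<^sub>v (\<mu> \<cdot>\<^sub>v s)"
    unfolding w_def by (rule mult_minus_distrib_mat_vec[OF R(2) Rs \<mu>s])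
  also have "R *\<^sub>v (R *\<^sub>v s) = \<mu>\<^sup>2 \<cdot>\<^sub>v s"
    using assoc_mult_mat_vec[OF R(2) R(2) s(1)] s(2) by simp
  also have "R *\<^sub>v (\<mu> \<cdot>\<^sub>v s) = \<mu> \<cdot>\<^sub>v (R *\<^sub>v s)"
    by (rule mult_mat_vec[OF R(2) s(1)])
  also have "\<mu>\<^sup>2 \<cdot>\<^sub>v s - \<mu> \<cdot>\<^sub>v (R *\<^sub>v s) = (- \<mu>) \<cdot>\<^sub>v w"
    using carrier_vecD[OF Rs] carrier_vecD[OF s(1)]
    by (intro eq_vecI) (auto simp: w_def power2_eq_square algebra_simps)
  finally have Rw: "R *\<^sub>v w = (- \<mu>) \<cdot>\<^sub>v w" .
  have "w = 0\<^sub>v n"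
  proof (rule ccontr)
    assume "w \<noteq> 0\<^sub>v n"
    then have "0 < w \<bullet> (R *\<^sub>v w)"
      by (rule spd_mat_quad_pos[OF R w])
    also have "\<dots> = - \<mu> * (w \<bullet> w)"
      unfolding Rw using w by simp
    also have "\<dots> \<le> 0"
      using \<mu> by (simp add: scalar_prod_def sum_nonneg)
    finally show False by simp
  qed
  then have "(R *\<^sub>v s) $ i - \<mu> * s $ i = 0" if "i < n" for i
  proof -
    have "w $ i = (R *\<^sub>v s) $ i - \<mu> * s $ i"
      unfolding w_def using that carrier_vecD[OF s(1)] by simp
    then show ?thesis
      using that \<open>w = 0\<^sub>v n\<close> by simp
  qed
  then show ?thesis
    using Rs s R by (intro eq_vecI) auto
qed

text \<open>Any positive definite root has to agree with the candidate on the columns of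
  \<open>S\<close>, and \<open>S\<close> is invertible; this gives the uniqueness that the definite
  description requires.\<close>

lemma spd_sqrt_conj_diag:
  assumes P: "spd_mat (S * mat_diag n f * S)"
    and S: "S \<in> carrier_mat n n" "transpose_mat S = S" "S * S = 1\<^sub>m n"
  shows "spd_sqrt (S * mat_diag n f * S) = S * mat_diag n (\<lambda>k. sqrt (f k)) * S"
    and "spd_mat (S * mat_diag n (\<lambda>k. sqrt (f k)) * S)"
    and "(S * mat_diag n (\<lambda>k. sqrt (f k)) * S) * (S * mat_diag n (\<lambda>k. sqrt (f k)) * S)
      = S * mat_diag n f * S"
proof -
  let ?P = "S * mat_diag n f * S"
  let ?D = "mat_diag n (\<lambda>k. sqrt (f k))"
  let ?R = "S * ?D * S"
  have Pc: "?P \<in> carrier_mat n n" and SD: "S * ?D \<in> carrier_mat n n" and DS: "?D * S \<in> carrier_mat n n"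
    using S mult_carrier_mat[OF mat_diag_dim S(1)] by auto
  \<comment> \<open>Column \<open>k\<close> of \<open>S\<close> is a unit eigenvector, so
    \<open>f k\<close> is a value of the positive form.\<close>
  have f: "0 < f k" if k: "k < n" for k
  proof -
    have s: "col S k \<in> carrier_vec n"
      by (rule col_carrier_vec[OF k S(1)])
    have "col S k = row (transpose_mat S) k"
      using carrier_matD(2)[OF S(1)] k by simp
    then have "row S k = col S k"
      by (simp only: S(2))
    then have "col S k \<bullet> col S k = (S * S) $$ (k, k)"
      using carrier_matD[OF S(1)] k by simp
    then have ss: "col S k \<bullet> col S k = 1"
      using S(3) k by simp
    then have "col S k \<noteq> 0\<^sub>v n"
      by auto
    then have "0 < col S k \<bullet> (?P *\<^sub>v col S k)"
      by (rule spd_mat_quad_pos[OF P Pc s])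
    also have "\<dots> = f k"
      unfolding mult_vec_col_conj_diag[OF S(1,3) k] using s ss by simp
    finally show ?thesis .
  qed
  show R: "spd_mat ?R"
    by (rule spd_mat_diag_conj[OF S]) (use f in simp)
  have "?D * ?D = mat_diag n f"
    unfolding mat_diag_diag using f by (intro eq_matI) (auto simp: mat_diag_def less_imp_le)
  moreover have "?R * ?R = S * (?D * ?D) * S"
  proof -
    have "?R * ?R = S * ?D * (S * ?R)"
      by (rule assoc_mult_mat[OF SD S(1) mult_carrier_mat[OF SD S(1)]])
    also have "S * ?R = S * (S * (?D * S))"
      by (simp add: assoc_mult_mat[OF S(1) mat_diag_dim S(1)])
    also have "\<dots> = ?D * S"
      using assoc_mult_mat[OF S(1) S(1) DS] S(3) left_mult_one_mat[OF DS] by simp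
    also have "S * ?D * (?D * S) = S * ?D * ?D * S"
      by (rule assoc_mult_mat[OF SD mat_diag_dim S(1), symmetric])
    finally show ?thesis
      by (simp only: assoc_mult_mat[OF S(1) mat_diag_dim mat_diag_dim])
  qed
  ultimately show RR: "?R * ?R = ?P"
    by simp
  show "spd_sqrt ?P = ?R"
    unfolding spd_sqrt_def
  proof (rule the_equality)
    fix Q
    assume Q: "spd_mat Q \<and> Q * Q = ?P"
    then have "dim_row (Q * Q) = dim_row ?P"
      by simp
    then have "dim_row Q = n"
      using carrier_matD(1)[OF S(1)] by simp
    then have Qc: "Q \<in> carrier_mat n n"
      using Q by (auto simp: spd_mat_def)
    have "Q * S = S * ?D"
    proof (rule mat_col_eqI)
      fix k
      assume "k < dim_col (S * ?D)"
      then have k: "k < n"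
        by (simp add: mat_diag_def)
      have "Q *\<^sub>v col S k = sqrt (f k) \<cdot>\<^sub>v col S k"
      proof (rule spd_root_eigenvector[OF _ Qc])
        show "(Q * Q) *\<^sub>v col S k = (sqrt (f k))\<^sup>2 \<cdot>\<^sub>v col S k"
          using Q mult_vec_col_conj_diag[OF S(1,3) k] f[OF k] by simp
      qed (use Q f[OF k] col_carrier_vec[OF k S(1)] in simp_all)
      then show "col (Q * S) k = col (S * ?D) k"
        using col_mult2[OF Qc S(1) k] col_mult_mat_diag[OF S(1) k] by simp
    qed (use carrier_matD[OF Qc] carrier_matD[OF S(1)] in \<open>simp_all add: mat_diag_def\<close>)
    then have "?R = Q * S * S"
      by simp
    also have "\<dots> = Q"
      using assoc_mult_mat[OF Qc S(1) S(1)] S(3) right_mult_one_mat[OF Qc] by simp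
    finally show "Q = ?R" ..
  qed (use R RR in simp)
qed

lemma spd_mat_Units:
  assumes "spd_mat R" "R \<in> carrier_mat n n"
  shows "R \<in> Units (ring_mat TYPE(real) n b)"
proof (rule det_non_zero_imp_unit[OF assms(2)])
  show "det R \<noteq> 0"
  proof
    assume "det R = 0"
    then obtain v where "v \<in> carrier_vec n" "v \<noteq> 0\<^sub>v n" "R *\<^sub>v v = 0\<^sub>v n"
      using det_0_iff_vec_prod_zero[OF assms(2)] by blast
    then show False
      using assms by (auto simp: spd_mat_def)
  qed
qed

text \<open>Hides the definite description and the partial inverse: later arguments use only these
  algebraic properties of the inverse root.\<close>

lemma inv_sqrt_mat_diagonalized:
  assumes P: "spd_mat P" "diagonalized_by n S P"
    and S: "transpose_mat S = S" "S * S = 1\<^sub>m n"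
  obtains R where "R \<in> carrier_mat n n" "R * R = P" "inv_sqrt_mat P \<in> carrier_mat n n"
    "transpose_mat (inv_sqrt_mat P) = inv_sqrt_mat P" "R * inv_sqrt_mat P = 1\<^sub>m n" "inv_sqrt_mat P * R = 1\<^sub>m n"
proof -
  obtain f where Pf: "P = S * mat_diag n f * S" and Sc: "S \<in> carrier_mat n n"
    using P(2) by (auto simp: diagonalized_by_def)
  define R where "R = S * mat_diag n (\<lambda>k. sqrt (f k)) * S"
  note sq = spd_sqrt_conj_diag[OF P(1)[unfolded Pf] Sc S, folded Pf R_def]
  have Rc: "R \<in> carrier_mat n n"
    using Sc by (auto simp: R_def)
  obtain B where B: "mat_inverse R = Some B"
    using mat_inverse(1)[OF Rc] spd_mat_Units[OF sq(2) Rc] by fastforce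
  then have inv: "inv_sqrt_mat P = B"
    by (simp add: inv_sqrt_mat_def sq(1))
  have RB: "R * B = 1\<^sub>m n" "B * R = 1\<^sub>m n" and Bc: "B \<in> carrier_mat n n"
    using mat_inverse(2)[OF Rc B] by auto
  have Bt: "transpose_mat B \<in> carrier_mat n n"
    using Bc by simp
  have "transpose_mat R = R"
    using sq(2) by (simp add: spd_mat_def)
  then have "transpose_mat B * R = 1\<^sub>m n"
    using transpose_mult[OF Rc Bc] RB(1) by simp
  then have "transpose_mat B = B"
    using assoc_mult_mat[OF Bt Rc Bc] RB(1) left_mult_one_mat[OF Bc] right_mult_one_mat[OF Bt] by simp
  then show ?thesis
    using that[OF Rc sq(3)] inv Bc RB by simp
qed

text \<open>With the eigenvector split as \<open>x + i y\<close>, symmetry of the real form applied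
  to \<open>x\<close> and \<open>y\<close> gives \<open>Im z * (|x|^2 + |y|^2) = 0\<close>.
  Whichever of \<open>x\<close> and \<open>y\<close> is nonzero is a real eigenvector.\<close>

lemma symmetric_eigenvalue_real:
  fixes K :: "real mat"
  assumes K: "K \<in> carrier_mat n n" "transpose_mat K = K"
    and ev: "z \<in> spectrum (map_mat complex_of_real K)"
  obtains a x where "z = complex_of_real a" "x \<in> carrier_vec n" "x \<noteq> 0\<^sub>v n" "K *\<^sub>v x = a \<cdot>\<^sub>v x"
proof -
  obtain v where "eigenvector (map_mat complex_of_real K) v z"
    using ev by (auto simp: spectrum_def eigenvalue_def)
  then have v: "v \<in> carrier_vec n" "v \<noteq> 0\<^sub>v n" "map_mat complex_of_real K *\<^sub>v v = z \<cdot>\<^sub>v v"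
    using K by (auto simp: eigenvector_def)
  define x where "x = map_vec Re v"
  define y where "y = map_vec Im v"
  have xy: "x \<in> carrier_vec n" "y \<in> carrier_vec n"
    using v by (auto simp: x_def y_def)
  have entry: "(\<Sum>j<n. complex_of_real (K $$ (i, j)) * v $ j) = z * v $ i" if "i < n" for i
    using arg_cong[OF v(3), of "\<lambda>u. u $ i"] that K v(1)
    by (simp add: scalar_prod_def lessThan_atLeast0)
  have Kxy: "K *\<^sub>v x = Re z \<cdot>\<^sub>v x - Im z \<cdot>\<^sub>v y" "K *\<^sub>v y = Re z \<cdot>\<^sub>v y + Im z \<cdot>\<^sub>v x"
    using arg_cong[OF entry, of _ Re] arg_cong[OF entry, of _ Im] K v(1)
    by (auto intro!: eq_vecI simp: x_def y_def scalar_prod_def lessThan_atLeast0)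
  have "y \<bullet> (K *\<^sub>v x) = (K *\<^sub>v y) \<bullet> x"
    using transpose_vec_mult_scalar[OF K(1) xy(1) xy(2)] K(2) by simp
  then have "Im z * (x \<bullet> x + y \<bullet> y) = 0"
    unfolding Kxy using xy comm_scalar_prod[OF xy]
    by (simp add: scalar_prod_minus_distrib[of _ n] add_scalar_prod_distrib[of _ n] distrib_left)
  moreover have "0 < x \<bullet> x + y \<bullet> y"
  proof -
    obtain i where i: "i < n" "v $ i \<noteq> 0"
      using v by (auto simp: vec_eq_iff)
    have "x \<bullet> x + y \<bullet> y = (\<Sum>i<n. x $ i * x $ i + y $ i * y $ i)"
      using xy by (simp add: scalar_prod_def lessThan_atLeast0 sum.distrib)
    also have "\<dots> > 0"
    proof (rule sum_pos2[of _ i])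
      show "0 < x $ i * x $ i + y $ i * y $ i"
        using i v(1) by (auto simp: x_def y_def complex_eq_iff sum_squares_gt_zero_iff)
    qed (use i in auto)
    finally show ?thesis .
  qed
  ultimately have im: "Im z = 0"
    by simp
  then have "K *\<^sub>v x = Re z \<cdot>\<^sub>v x" "K *\<^sub>v y = Re z \<cdot>\<^sub>v y"
    unfolding Kxy using xy by auto
  moreover have "x \<noteq> 0\<^sub>v n \<or> y \<noteq> 0\<^sub>v n"
    using \<open>0 < x \<bullet> x + y \<bullet> y\<close> by auto
  moreover have "z = complex_of_real (Re z)"
    using im by (simp add: complex_eq_iff)
  ultimately show ?thesis
    using that xy by blast
qed

section \<open>The three-dimensional problem\<close>

lemma kron_combination_carrier:
  assumes "\<forall>i\<in>{1, 2, 3}. X i \<in> carrier_mat (n i) (n i)"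
  shows "kron_combination n e X \<in> carrier_mat (n 3 * (n 2 * n 1)) (n 3 * (n 2 * n 1))"
  unfolding kron_combination_def using assms by (intro add_carrier_mat smult_carrier_mat kron_carrier) auto

text \<open>Splits an index into its three mixed-radix digits, so that linear identities between
  combinations reduce to identities between numbers.\<close>

lemma kron_combination_index:
  assumes X: "\<forall>i\<in>{1, 2, 3}. X i \<in> carrier_mat (n i) (n i)"
    and i: "i < n 3 * (n 2 * n 1)" and j: "j < n 3 * (n 2 * n 1)"
  defines "i3 \<equiv> i div (n 2 * n 1)" and "j3 \<equiv> j div (n 2 * n 1)"
    and "i2 \<equiv> i mod (n 2 * n 1) div n 1" and "j2 \<equiv> j mod (n 2 * n 1) div n 1"
    and "i1 \<equiv> i mod (n 2 * n 1) mod n 1" and "j1 \<equiv> j mod (n 2 * n 1) mod n 1"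
  shows "kron_combination n e X $$ (i, j) =
      A_mat (n 3) $$ (i3, j3) * (A_mat (n 2) $$ (i2, j2) * A_mat (n 1) $$ (i1, j1))
      + e 1 * (A_mat (n 3) $$ (i3, j3) * (A_mat (n 2) $$ (i2, j2) * X 1 $$ (i1, j1)))
      + e 2 * (A_mat (n 3) $$ (i3, j3) * (X 2 $$ (i2, j2) * A_mat (n 1) $$ (i1, j1)))
      + e 3 * (X 3 $$ (i3, j3) * (A_mat (n 2) $$ (i2, j2) * A_mat (n 1) $$ (i1, j1)))"
    and "i3 < n 3" "j3 < n 3" "i2 < n 2" "j2 < n 2" "i1 < n 1" "j1 < n 1"
proof -
  note bounds = div_mod_less_mult[OF i] div_mod_less_mult[OF j]
  note bounds' = div_mod_less_mult[OF bounds(2)] div_mod_less_mult[OF bounds(4)]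
  show "i3 < n 3" "j3 < n 3" "i2 < n 2" "j2 < n 2" "i1 < n 1" "j1 < n 1"
    using bounds bounds' by (simp_all add: i3_def j3_def i2_def j2_def i1_def j1_def)
  have kron3: "(A \<otimes>\<^sub>K B \<otimes>\<^sub>K C) $$ (i, j) = A $$ (i3, j3) * (B $$ (i2, j2) * C $$ (i1, j1))"
      "A \<otimes>\<^sub>K B \<otimes>\<^sub>K C \<in> carrier_mat (n 3 * (n 2 * n 1)) (n 3 * (n 2 * n 1))"
    if "A \<in> carrier_mat (n 3) (n 3)" "B \<in> carrier_mat (n 2) (n 2)" "C \<in> carrier_mat (n 1) (n 1)"
    for A B C
    using that i j bounds
    by (simp_all add: kron_index[of A "n 3" "n 3" _ "n 2 * n 1" "n 2 * n 1"]
        kron_index[of B "n 2" "n 2" _ "n 1" "n 1"] i3_def j3_def i2_def j2_def i1_def j1_def)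
  note k0 = kron3[OF A_mat_carrier A_mat_carrier A_mat_carrier]
    and k1 = kron3[OF A_mat_carrier A_mat_carrier bspec[OF X, of 1]]
    and k2 = kron3[OF A_mat_carrier bspec[OF X, of 2] A_mat_carrier]
    and k3 = kron3[OF bspec[OF X, of 3] A_mat_carrier A_mat_carrier]
  show "kron_combination n e X $$ (i, j) =
      A_mat (n 3) $$ (i3, j3) * (A_mat (n 2) $$ (i2, j2) * A_mat (n 1) $$ (i1, j1))
      + e 1 * (A_mat (n 3) $$ (i3, j3) * (A_mat (n 2) $$ (i2, j2) * X 1 $$ (i1, j1)))
      + e 2 * (A_mat (n 3) $$ (i3, j3) * (X 2 $$ (i2, j2) * A_mat (n 1) $$ (i1, j1)))
      + e 3 * (X 3 $$ (i3, j3) * (A_mat (n 2) $$ (i2, j2) * A_mat (n 1) $$ (i1, j1)))"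
    using i j carrier_matD[OF k0(2)] carrier_matD[OF k1(2)] carrier_matD[OF k2(2)] carrier_matD[OF k3(2)]
    by (simp add: kron_combination_def k0(1) k1(1) k2(1) k3(1) del: One_nat_def)
qed

text \<open>The product without any \<open>X\<close> or \<open>Y\<close> occurs in both combinations
  and receives the weight \<open>c + d\<close>. Factoring it out leaves a combination of the same
  shape, to which positivity can be applied direction by direction.\<close>

lemma kron_combination_lincomb:
  assumes X: "\<forall>i\<in>{1, 2, 3}. X i \<in> carrier_mat (n i) (n i)"
    and Y: "\<forall>i\<in>{1, 2, 3}. Y i \<in> carrier_mat (n i) (n i)"
    and cd: "c + d \<noteq> 0"
  shows "c \<cdot>\<^sub>m kron_combination n e X + d \<cdot>\<^sub>m kron_combination n e Y =
      (c + d) \<cdot>\<^sub>m kron_combination n (\<lambda>i. e i / (c + d)) (\<lambda>i. c \<cdot>\<^sub>m X i + d \<cdot>\<^sub>m Y i)"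
proof (rule eq_matI)
  let ?Z = "\<lambda>i. c \<cdot>\<^sub>m X i + d \<cdot>\<^sub>m Y i" and ?e = "\<lambda>i. e i / (c + d)"
  have Z: "\<forall>i\<in>{1, 2, 3}. ?Z i \<in> carrier_mat (n i) (n i)"
    using X Y by auto
  note dims = carrier_matD[OF kron_combination_carrier[of X n e, OF X]]
    carrier_matD[OF kron_combination_carrier[of Y n e, OF Y]]
    carrier_matD[OF kron_combination_carrier[of ?Z n ?e, OF Z]]
  fix i j
  assume "i < dim_row ((c + d) \<cdot>\<^sub>m kron_combination n ?e ?Z)" "j < dim_col ((c + d) \<cdot>\<^sub>m kron_combination n ?e ?Z)"
  then have ij: "i < n 3 * (n 2 * n 1)" "j < n 3 * (n 2 * n 1)"
    using dims by simp_all
  note iX = kron_combination_index[of X n i j, OF X ij]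
    and iY = kron_combination_index[of Y n i j, OF Y ij]
    and iZ = kron_combination_index[of ?Z n i j, OF Z ij]
  have Zi: "?Z k $$ (p, q) = c * X k $$ (p, q) + d * Y k $$ (p, q)" if "k \<in> {1, 2, 3}" "p < n k" "q < n k" for k p q
    using bspec[OF X that(1)] bspec[OF Y that(1)] that by auto
  note Zis = Zi[of 1, OF _ iX(6,7)] Zi[of 2, OF _ iX(4,5)] Zi[of 3, OF _ iX(2,3)]
  have rescale: "(c + d) * (p + e 1 / (c + d) * x + e 2 / (c + d) * y + e 3 / (c + d) * z) =
      (c + d) * p + e 1 * x + e 2 * y + e 3 * z" for p x y z
    using cd by (simp add: distrib_left[of "c + d"])
  have "(c \<cdot>\<^sub>m kron_combination n e X + d \<cdot>\<^sub>m kron_combination n e Y) $$ (i, j) =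
      c * kron_combination n e X $$ (i, j) + d * kron_combination n e Y $$ (i, j)"
    using ij dims by simp
  also have "\<dots> = (c + d) * kron_combination n ?e ?Z $$ (i, j)"
    unfolding iX(1) iY(1) iZ(1) rescale
    by (simp add: Zis del: One_nat_def) (simp add: algebra_simps)
  also have "\<dots> = ((c + d) \<cdot>\<^sub>m kron_combination n ?e ?Z) $$ (i, j)"
    using ij dims by simp
  finally show "(c \<cdot>\<^sub>m kron_combination n e X + d \<cdot>\<^sub>m kron_combination n e Y) $$ (i, j) =
      ((c + d) \<cdot>\<^sub>m kron_combination n ?e ?Z) $$ (i, j)" .
next
  let ?Z = "\<lambda>i. c \<cdot>\<^sub>m X i + d \<cdot>\<^sub>m Y i" and ?e = "\<lambda>i. e i / (c + d)"
  have Z: "\<forall>i\<in>{1, 2, 3}. ?Z i \<in> carrier_mat (n i) (n i)"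
    using X Y by auto
  show "dim_row (c \<cdot>\<^sub>m kron_combination n e X + d \<cdot>\<^sub>m kron_combination n e Y) = dim_row ((c + d) \<cdot>\<^sub>m kron_combination n ?e ?Z)"
    "dim_col (c \<cdot>\<^sub>m kron_combination n e X + d \<cdot>\<^sub>m kron_combination n e Y) = dim_col ((c + d) \<cdot>\<^sub>m kron_combination n ?e ?Z)"
    using carrier_matD[OF kron_combination_carrier[of Y n e, OF Y]]
      carrier_matD[OF kron_combination_carrier[of ?Z n ?e, OF Z]] by simp_all
qed

lemma transpose_kron_combination:
  assumes X: "\<forall>i\<in>{1, 2, 3}. X i \<in> carrier_mat (n i) (n i)"
  shows "transpose_mat (kron_combination n e X) = kron_combination n e (\<lambda>i. transpose_mat (X i))"
proof (rule eq_matI)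
  let ?Y = "\<lambda>i. transpose_mat (X i)"
  have Y: "\<forall>i\<in>{1, 2, 3}. ?Y i \<in> carrier_mat (n i) (n i)"
    using X by simp
  note dims = carrier_matD[OF kron_combination_carrier[of X n e, OF X]]
    carrier_matD[OF kron_combination_carrier[of ?Y n e, OF Y]]
  fix i j
  assume "i < dim_row (kron_combination n e ?Y)" "j < dim_col (kron_combination n e ?Y)"
  then have ij: "i < n 3 * (n 2 * n 1)" "j < n 3 * (n 2 * n 1)"
    using dims by simp_all
  note iX = kron_combination_index[of X n j i, OF X ij(2,1)]
    and iY = kron_combination_index[of ?Y n i j, OF Y ij]
  have A: "A_mat m $$ (q, p) = A_mat m $$ (p, q)" if "p < m" "q < m" for m p q
    using that by (auto simp: A_mat_def)
  have Yi: "?Y k $$ (p, q) = X k $$ (q, p)" if "k \<in> {1, 2, 3}" "p < n k" "q < n k" for k p q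
    using bspec[OF X that(1)] that by auto
  have "transpose_mat (kron_combination n e X) $$ (i, j) = kron_combination n e X $$ (j, i)"
    using ij dims by simp
  also have "\<dots> = kron_combination n e ?Y $$ (i, j)"
    unfolding iX(1) iY(1)
    by (simp add: Yi[of 1, OF _ iY(6,7)] Yi[of 2, OF _ iY(4,5)] Yi[of 3, OF _ iY(2,3)]
        A[OF iY(6,7)] A[OF iY(4,5)] A[OF iY(2,3)] del: One_nat_def)
  finally show "transpose_mat (kron_combination n e X) $$ (i, j) = kron_combination n e ?Y $$ (i, j)" .
next
  let ?Y = "\<lambda>i. transpose_mat (X i)"
  have Y: "\<forall>i\<in>{1, 2, 3}. ?Y i \<in> carrier_mat (n i) (n i)"
    using X by simp
  show "dim_row (transpose_mat (kron_combination n e X)) = dim_row (kron_combination n e ?Y)"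
    "dim_col (transpose_mat (kron_combination n e X)) = dim_col (kron_combination n e ?Y)"
    using carrier_matD[OF kron_combination_carrier[of X n e, OF X]]
      carrier_matD[OF kron_combination_carrier[of ?Y n e, OF Y]] by simp_all
qed

lemma sym_part_eq:
  assumes "Z \<in> carrier_mat m m"
  shows "sym_part Z = (1/2) \<cdot>\<^sub>m Z + (1/2) \<cdot>\<^sub>m transpose_mat Z"
  using assms by (intro eq_matI) (auto simp: sym_part_def)

lemma transpose_sym_part:
  assumes "Z \<in> carrier_mat m m"
  shows "transpose_mat (sym_part Z) = sym_part Z"
  using assms by (intro eq_matI) (auto simp: sym_part_def add.commute)

text \<open>The case \<open>c = d = 1/2\<close> of the previous identity, with the transpose as
  second family: the weights add up to 1, so \<open>e\<close> is unchanged.\<close>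

lemma sym_part_kron_combination:
  assumes X: "\<forall>i\<in>{1, 2, 3}. X i \<in> carrier_mat (n i) (n i)"
  shows "sym_part (kron_combination n e X) = kron_combination n e (\<lambda>i. sym_part (X i))"
proof -
  let ?Y = "\<lambda>i. transpose_mat (X i)"
  have Y: "\<forall>i\<in>{1, 2, 3}. ?Y i \<in> carrier_mat (n i) (n i)"
    using X by simp
  have "sym_part (kron_combination n e X) =
      (1/2) \<cdot>\<^sub>m kron_combination n e X + (1/2) \<cdot>\<^sub>m kron_combination n e ?Y"
    unfolding sym_part_eq[OF kron_combination_carrier[of X n e, OF X]] transpose_kron_combination[of X n e, OF X] ..
  also have "\<dots> = kron_combination n e (\<lambda>i. (1/2) \<cdot>\<^sub>m X i + (1/2) \<cdot>\<^sub>m ?Y i)"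
    by (subst kron_combination_lincomb[OF X Y]) (auto intro!: eq_matI)
  also have "\<dots> = kron_combination n e (\<lambda>i. sym_part (X i))"
    unfolding kron_combination_def
    using sym_part_eq[OF bspec[OF X, of 1]] sym_part_eq[OF bspec[OF X, of 2]] sym_part_eq[OF bspec[OF X, of 3]] by simp
  finally show ?thesis .
qed

lemma kron_combination_spd:
  assumes X: "\<forall>i\<in>{1, 2, 3}. X i \<in> carrier_mat (n i) (n i)"
    and e: "\<And>i. i \<in> {1, 2, 3} \<Longrightarrow> 0 < e i"
    and spd: "\<And>i. i \<in> {1, 2, 3} \<Longrightarrow> spd_mat (X i)"
  shows "spd_mat (kron_combination n e X)"
proof -
  have kron3: "spd_mat (A \<otimes>\<^sub>K B \<otimes>\<^sub>K C)"
    "A \<otimes>\<^sub>K B \<otimes>\<^sub>K C \<in> carrier_mat (n 3 * (n 2 * n 1)) (n 3 * (n 2 * n 1))"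
    if "spd_mat A" "spd_mat B" "spd_mat C" "A \<in> carrier_mat (n 3) (n 3)" "B \<in> carrier_mat (n 2) (n 2)"
      "C \<in> carrier_mat (n 1) (n 1)" for A B C
    using that kron_spd[OF that(1) kron_spd[OF that(2,3,5,6)] that(4) kron_carrier[OF that(5,6)]] by auto
  note k0 = kron3[OF spd_A_mat spd_A_mat spd_A_mat A_mat_carrier A_mat_carrier A_mat_carrier]
    and k1 = kron3[OF spd_A_mat spd_A_mat spd A_mat_carrier A_mat_carrier bspec[OF X]]
    and k2 = kron3[OF spd_A_mat spd spd_A_mat A_mat_carrier bspec[OF X] A_mat_carrier]
    and k3 = kron3[OF spd spd_A_mat spd_A_mat bspec[OF X] A_mat_carrier A_mat_carrier]
  show ?thesis
    unfolding kron_combination_def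
    by (intro spd_mat_add[where n = "n 3 * (n 2 * n 1)"] spd_mat_smult[where n = "n 3 * (n 2 * n 1)"]
        add_carrier_mat smult_carrier_mat k0 k1 k2 k3 e) simp_all
qed

lemma kron_combination_lincomb_spd:
  assumes X: "\<forall>i\<in>{1, 2, 3}. X i \<in> carrier_mat (n i) (n i)"
    and Y: "\<forall>i\<in>{1, 2, 3}. Y i \<in> carrier_mat (n i) (n i)"
    and e: "\<And>i. i \<in> {1, 2, 3} \<Longrightarrow> 0 < e i"
    and cd: "0 < c + d"
    and spd: "\<And>i. i \<in> {1, 2, 3} \<Longrightarrow> spd_mat (c \<cdot>\<^sub>m X i + d \<cdot>\<^sub>m Y i)"
  shows "spd_mat (c \<cdot>\<^sub>m kron_combination n e X + d \<cdot>\<^sub>m kron_combination n e Y)"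
proof -
  let ?K = "kron_combination n (\<lambda>i. e i / (c + d)) (\<lambda>i. c \<cdot>\<^sub>m X i + d \<cdot>\<^sub>m Y i)"
  have Z: "\<forall>i\<in>{1, 2, 3}. c \<cdot>\<^sub>m X i + d \<cdot>\<^sub>m Y i \<in> carrier_mat (n i) (n i)"
    using X Y by auto
  have "spd_mat ?K"
    using e cd by (intro kron_combination_spd Z spd) auto
  then have "spd_mat ((c + d) \<cdot>\<^sub>m ?K)"
    using cd by (rule spd_mat_smult) (rule kron_combination_carrier[OF Z])
  then show ?thesis
    using kron_combination_lincomb[OF X Y, where c = c and d = d and e = e] cd by simp
qed

lemma diagonalized_by_tau_mat:
  assumes "A \<in> carrier_mat n n"
  shows "diagonalized_by n (S_mat n) (tau_mat A)"
  unfolding diagonalized_by_def tau_mat_def using assms by auto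

lemma kron_combination_tau_diagonalized:
  assumes X: "\<forall>i\<in>{1, 2, 3}. X i \<in> carrier_mat (n i) (n i)"
  shows "diagonalized_by (n 3 * (n 2 * n 1)) (S_mat (n 3) \<otimes>\<^sub>K S_mat (n 2) \<otimes>\<^sub>K S_mat (n 1))
    (kron_combination n e (\<lambda>i. tau_mat (X i)))"
proof -
  have "diagonalized_by (n i) (S_mat (n i)) (A_mat (n i))" for i
    using diagonalized_by_tau_mat[OF A_mat_carrier] by (simp add: tau_A_mat)
  then show ?thesis
    unfolding kron_combination_def
    by (intro diagonalized_by_add diagonalized_by_smult diagonalized_by_kron)
      (use X in \<open>auto intro!: diagonalized_by_tau_mat\<close>)
qed

lemma kron_S_mat_involution:
  fixes l m n S
  defines "S \<equiv> S_mat l \<otimes>\<^sub>K S_mat m \<otimes>\<^sub>K S_mat n"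
  shows "transpose_mat S = S" "S * S = 1\<^sub>m (l * (m * n))"
proof -
  show "transpose_mat S = S"
    by (simp add: S_def transpose_kron)
  have "(S_mat m \<otimes>\<^sub>K S_mat n) * (S_mat m \<otimes>\<^sub>K S_mat n) = 1\<^sub>m (m * n)"
    using kron_mult[OF S_mat_carrier S_mat_carrier S_mat_carrier S_mat_carrier, of m n] by (simp add: kron_one)
  then show "S * S = 1\<^sub>m (l * (m * n))"
    unfolding S_def
    using kron_mult[OF S_mat_carrier kron_carrier[OF S_mat_carrier S_mat_carrier]
        S_mat_carrier kron_carrier[OF S_mat_carrier S_mat_carrier], of l m n]
    by (simp add: kron_one)
qed

text \<open>An eigenvector \<open>x\<close> of the congruence transform yields \<open>y = P\<^sup>-\<^sup>1\<^sup>/\<^sup>2 x\<close> with \<open>H y = a P y\<close>, so \<open>a\<close> is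
  a generalized Rayleigh quotient.\<close>

lemma precond_spectrum:
  assumes P: "P \<in> carrier_mat N N" "spd_mat P" "diagonalized_by N S P"
    and S: "transpose_mat S = S" "S * S = 1\<^sub>m N"
    and H: "H \<in> carrier_mat N N" "transpose_mat H = H"
    and lower: "spd_mat (1 \<cdot>\<^sub>m H + (- l) \<cdot>\<^sub>m P)"
    and upper: "spd_mat ((- 1) \<cdot>\<^sub>m H + u \<cdot>\<^sub>m P)"
  shows "spectrum (map_mat complex_of_real (inv_sqrt_mat P * H * inv_sqrt_mat P))
    \<subseteq> complex_of_real ` {l <..< u}"
proof
  fix z
  assume z: "z \<in> spectrum (map_mat complex_of_real (inv_sqrt_mat P * H * inv_sqrt_mat P))"
  obtain R where R: "R \<in> carrier_mat N N" "R * R = P" and B: "inv_sqrt_mat P \<in> carrier_mat N N"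
    "transpose_mat (inv_sqrt_mat P) = inv_sqrt_mat P" "R * inv_sqrt_mat P = 1\<^sub>m N"
    "inv_sqrt_mat P * R = 1\<^sub>m N"
    using inv_sqrt_mat_diagonalized[OF P(2,3) S] by metis
  define B where "B = inv_sqrt_mat P"
  note B = B[folded B_def]
  have BH: "B * H \<in> carrier_mat N N" and K: "B * H * B \<in> carrier_mat N N"
    using B(1) H(1) by auto
  have "transpose_mat (B * H * B) = B * (H * B)"
    by (simp add: transpose_mult[OF BH B(1)] transpose_mult[OF B(1) H(1)] B(2) H(2))
  also have "\<dots> = B * H * B"
    by (rule assoc_mult_mat[OF B(1) H(1) B(1), symmetric])
  finally have Kt: "transpose_mat (B * H * B) = B * H * B" .
  obtain a x where ax: "z = complex_of_real a" "x \<in> carrier_vec N" "x \<noteq> 0\<^sub>v N"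
    "(B * H * B) *\<^sub>v x = a \<cdot>\<^sub>v x"
    using symmetric_eigenvalue_real[OF K Kt z[folded B_def]] by metis
  define y where "y = B *\<^sub>v x"
  have y: "y \<in> carrier_vec N" and Hy: "H *\<^sub>v y \<in> carrier_vec N"
    using B(1) H(1) ax(2) by (auto simp: y_def)
  have Ry: "R *\<^sub>v y = x"
    unfolding y_def using assoc_mult_mat_vec[OF R(1) B(1) ax(2)] B(3) ax(2) by simp
  have y0: "y \<noteq> 0\<^sub>v N"
    using Ry R(1) ax(3) by auto
  have "B *\<^sub>v (H *\<^sub>v y) = a \<cdot>\<^sub>v x"
    using ax(4) assoc_mult_mat_vec[OF BH B(1) ax(2)] assoc_mult_mat_vec[OF B(1) H(1) y]
    by (simp add: y_def)
  \<comment> \<open>Multiplication by \<open>R\<close> cancels the outer inverse root, and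
    \<open>R x = R (R y) = P y\<close>.\<close>
  then have "R *\<^sub>v (B *\<^sub>v (H *\<^sub>v y)) = a \<cdot>\<^sub>v (R *\<^sub>v x)"
    using mult_mat_vec[OF R(1) ax(2)] by simp
  then have "H *\<^sub>v y = a \<cdot>\<^sub>v (R *\<^sub>v x)"
    using assoc_mult_mat_vec[OF R(1) B(1) Hy] B(3) Hy by simp
  also have "R *\<^sub>v x = P *\<^sub>v y"
    using assoc_mult_mat_vec[OF R(1) R(1) y] Ry R(2) by simp
  finally have gen: "H *\<^sub>v y = a \<cdot>\<^sub>v (P *\<^sub>v y)" .
  have Py: "P *\<^sub>v y \<in> carrier_vec N"
    using P(1) y by auto
  have pos: "0 < y \<bullet> (P *\<^sub>v y)"
    by (rule spd_mat_quad_pos[OF P(2,1) y y0])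
  \<comment> \<open>On \<open>y\<close> the two definiteness hypotheses become the signs of
    \<open>a - l\<close> and \<open>u - a\<close>.\<close>
  have form: "y \<bullet> ((c \<cdot>\<^sub>m H + d \<cdot>\<^sub>m P) *\<^sub>v y) = (c * a + d) * (y \<bullet> (P *\<^sub>v y))" for c d
  proof -
    have "(c \<cdot>\<^sub>m H + d \<cdot>\<^sub>m P) *\<^sub>v y = c \<cdot>\<^sub>v (H *\<^sub>v y) + d \<cdot>\<^sub>v (P *\<^sub>v y)"
      using H(1) P(1) y
      by (intro eq_vecI) (auto simp: scalar_prod_def sum.distrib sum_distrib_left distrib_right mult.assoc)
    then show ?thesis
      unfolding gen using y Py by (simp add: scalar_prod_add_distrib[of _ N] algebra_simps)
  qed
  have "0 < y \<bullet> ((1 \<cdot>\<^sub>m H + (- l) \<cdot>\<^sub>m P) *\<^sub>v y)" "0 < y \<bullet> (((- 1) \<cdot>\<^sub>m H + u \<cdot>\<^sub>m P) *\<^sub>v y)"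
    using H(1) P(1) by (intro spd_mat_quad_pos[OF lower _ y y0] spd_mat_quad_pos[OF upper _ y y0]; simp)+
  then have "l < a" "a < u"
    unfolding form using pos by (auto simp: zero_less_mult_iff)
  then show "z \<in> complex_of_real ` {l <..< u}"
    using ax(1) by auto
qed

theorem lemma3p7:
  fixes T :: real and M :: nat
    and a b kp km \<delta> :: "nat \<Rightarrow> real" and n :: "nat \<Rightarrow> nat"
  assumes "0 < T" and "0 < M"
    and "\<And>i. i \<in> {1, 2, 3} \<Longrightarrow> 0 < \<delta> i \<and> \<delta> i < 1"
    and "\<And>i. i \<in> {1, 2, 3} \<Longrightarrow> a i < b i"
    and "\<And>i. i \<in> {1, 2, 3} \<Longrightarrow> 0 < kp i \<and> 0 < km i"
    and "\<And>i. i \<in> {1, 2, 3} \<Longrightarrow> 0 < n i"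
  shows "spectrum (map_mat complex_of_real
           (inv_sqrt_mat (precond_mat T M a b kp km n \<delta>)
            * sym_part (system_mat T M a b kp km n \<delta>)
            * inv_sqrt_mat (precond_mat T M a b kp km n \<delta>)))
         \<subseteq> complex_of_real ` {1/2 <..< 3/2}"
proof -
  define e where "e = eta_family T M a b n \<delta>"
  define B where "B i = B_mat (kp i) (km i) (n i) (\<delta> i)" for i
  define X where "X i = sym_part (B i)" for i
  define Y where "Y i = tau_mat (X i)" for i
  let ?N = "n 3 * (n 2 * n 1)" and ?P = "kron_combination n e Y"
  have B: "\<forall>i\<in>{1, 2, 3}. B i \<in> carrier_mat (n i) (n i)"
    and X: "\<forall>i\<in>{1, 2, 3}. X i \<in> carrier_mat (n i) (n i)"
    and Y: "\<forall>i\<in>{1, 2, 3}. Y i \<in> carrier_mat (n i) (n i)"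
    by (simp_all add: B_def X_def Y_def)
  have P: "precond_mat T M a b kp km n \<delta> = ?P"
    unfolding precond_mat_def e_def Y_def X_def B_def ..
  have H: "sym_part (system_mat T M a b kp km n \<delta>) = kron_combination n e X"
    unfolding system_mat_def e_def[symmetric] B_def[symmetric] X_def
    by (rule sym_part_kron_combination[OF B])
  have e: "0 < e i" if "i \<in> {1, 2, 3}" for i
    using assms(1,2) assms(3,4)[OF that]
    by (auto simp: e_def eta_family_def eta_def intro!: divide_pos_pos mult_pos_pos Gamma_real_pos powr_gt_zero[THEN iffD2])
  \<comment> \<open>Used three times: \<open>(0, 1)\<close> makes the preconditioner positive
    definite, \<open>(1, -1/2)\<close> and \<open>(-1, 3/2)\<close> give the two spectral
    bounds.\<close>
  have spd: "spd_mat (c \<cdot>\<^sub>m kron_combination n e X + d \<cdot>\<^sub>m ?P)"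
    if "0 < c + d" "d \<le> 3 * (c + d)" "- d \<le> c + d" for c d
    unfolding X_def Y_def B_def using that assms(3,5)
    by (intro kron_combination_lincomb_spd e sym_part_B_mat_tau_spd) auto
  have Hc: "kron_combination n e X \<in> carrier_mat ?N ?N" and Pc: "?P \<in> carrier_mat ?N ?N"
    by (intro kron_combination_carrier X Y)+
  have "0 \<cdot>\<^sub>m kron_combination n e X + 1 \<cdot>\<^sub>m ?P = ?P"
    using Hc Pc by (intro eq_matI) auto
  then have "spd_mat ?P"
    using spd[of 0 1] by simp
  moreover have "transpose_mat (kron_combination n e X) = kron_combination n e X"
    unfolding X_def sym_part_kron_combination[OF B, symmetric]
    by (rule transpose_sym_part[OF kron_combination_carrier[OF B]])
  moreover have "spd_mat (1 \<cdot>\<^sub>m kron_combination n e X + (- (1/2)) \<cdot>\<^sub>m ?P)"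
    "spd_mat ((- 1) \<cdot>\<^sub>m kron_combination n e X + (3/2) \<cdot>\<^sub>m ?P)"
    using spd[of 1 "- (1/2)"] spd[of "- 1" "3/2"] by simp_all
  ultimately show ?thesis
    unfolding P H
    using kron_combination_tau_diagonalized[of X n e, OF X] kron_S_mat_involution[of "n 3" "n 2" "n 1"]
    by (intro precond_spectrum[OF Pc _ _ _ _ Hc]) (simp_all add: Y_def[abs_def])
qed

end
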